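(* Let $\Pi$ be a commutative monoid. Then $\mathcal{P}(\Pi)$ is an irreducible spectral topological space. If $\Pi$ is finitely generated, then $\mathcal{P}(\Pi)$ is also $T_D$, i.e., every singleton is open in its closure. Furthermore, for any $n \in \mathbb{Z}_{\geq 1}$: (1) $\mathcal{P}(\mathrm{Mon}_n)$ is not Noetherian and has infinite Krull dimension. (2) $\mathcal{P}(\mathbb{Z}^n)$ has Krull dimension $n$; it is Noetherian if and only if $n=1$, and this is also the only case where $\mathcal{P}(\mathbb{Z}^n)$ is pure-dimensional.
   Context: A preorder on a commutative monoid $(\Pi,\cdot)$ is a binary relation $\leq$ on $\Pi$ that is reflexive, transitive, and total, and satisfies $v \leq w \Rightarrow uv \leq uw$ for all $u,v,w \in \Pi$. We write $u<v$ if $u \leq v$ but not $v \leq u$. $\mathcal{P}(\Pi)$ is the set of all preorders on $\Pi$, equipped with the coarsest topology in which, for all $u,v \in \Pi$, the set $\{{\leq} \in \mathcal{P}(\Pi) \mid u<v\}$ is closed. $\mathrm{Mon}_n=\{x^\alpha \mid \alpha \in \mathbb{Z}_{\geq 0}^n\}$ is the (multiplicative) monoid of monomials in $n$ variables; $\mathbb{Z}^n$ is a monoid under addition. A space is spectral if it is quasi-compact, $T_0$ and sober, and its quasi-compact open subsets are closed under finite intersections and form a basis of the topology. The Krull dimension is the supremum of the lengths of strictly decreasing chains of nonempty irreducible closed subsets (a chain $C_0 \supsetneq \cdots \supsetneq C_k$ has length $k$). Pure-dimensional means that all maximal chains of nonempty irreducible closed subsets have the same length. *)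

theory Defs
  imports
    "HOL-Analysis.Abstract_Topological_Spaces"
    "HOL-Algebra.Product_Groups"
    "HOL-Library.Extended_Nat"
begin

section \<open>Preorders on a commutative monoid\<close>

text \<open>A preorder is a relation on the carrier of the monoid; \<open>(u, v) \<in> r\<close> stands for \<open>u \<le> v\<close>.\<close>

definition monoid_preorders :: "('a, 'b) monoid_scheme \<Rightarrow> 'a rel set" where
  "monoid_preorders G =
     {r. preorder_on (carrier G) r \<and> total_on (carrier G) r \<and>
         (\<forall>u\<in>carrier G. \<forall>v\<in>carrier G. \<forall>w\<in>carrier G.
            (v, w) \<in> r \<longrightarrow> (u \<otimes>\<^bsub>G\<^esub> v, u \<otimes>\<^bsub>G\<^esub> w) \<in> r)}"

definition strictly_below :: "'a rel \<Rightarrow> 'a \<Rightarrow> 'a \<Rightarrow> bool" where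
  "strictly_below r u v \<longleftrightarrow> (u, v) \<in> r \<and> (v, u) \<notin> r"

text \<open>The coarsest topology in which the sets \<open>{r. u < v}\<close> are closed is the one generated by
  their complements; \<^term>\<open>topology_generated_by\<close> takes the union of the generators as the
  underlying space, so the whole space is inserted as a generator.\<close>

definition preorder_space :: "('a, 'b) monoid_scheme \<Rightarrow> 'a rel topology" where
  "preorder_space G =
     topology_generated_by
       (insert (monoid_preorders G)
         {monoid_preorders G - {r \<in> monoid_preorders G. strictly_below r u v} | u v.
            u \<in> carrier G \<and> v \<in> carrier G})"

lemma topspace_preorder_space [simp]: "topspace (preorder_space G) = monoid_preorders G"
  by (auto simp: preorder_space_def)

lemma closedin_preorder_space_strictly_below:
  assumes "u \<in> carrier G" "v \<in> carrier G"
  shows "closedin (preorder_space G) {r \<in> monoid_preorders G. strictly_below r u v}"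
proof -
  have "openin (preorder_space G)
          (monoid_preorders G - {r \<in> monoid_preorders G. strictly_below r u v})"
    unfolding preorder_space_def using assms by (intro topology_generated_by_Basis) blast
  then show ?thesis
    by (auto simp: closedin_def)
qed

lemma preorder_space_coarsest:
  assumes top: "topspace T = monoid_preorders G"
    and cl: "\<And>u v. u \<in> carrier G \<Longrightarrow> v \<in> carrier G \<Longrightarrow>
               closedin T {r \<in> monoid_preorders G. strictly_below r u v}"
    and op: "openin (preorder_space G) U"
  shows "openin T U"
proof (rule generate_topology_on_coarsest[where T = "openin T"])
  show "generate_topology_on
          (insert (monoid_preorders G)
            {monoid_preorders G - {r \<in> monoid_preorders G. strictly_below r u v} | u v.
               u \<in> carrier G \<and> v \<in> carrier G}) U"
    using op unfolding preorder_space_def by (simp add: openin_topology_generated_by_iff)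
next
  show "openin T S"
    if "S \<in> insert (monoid_preorders G)
            {monoid_preorders G - {r \<in> monoid_preorders G. strictly_below r u v} | u v.
               u \<in> carrier G \<and> v \<in> carrier G}" for S
    using that cl unfolding closedin_def top by (auto simp flip: top)
qed auto


section \<open>Monoids\<close>

definition finitely_generated_monoid :: "('a, 'b) monoid_scheme \<Rightarrow> bool" where
  "finitely_generated_monoid G \<longleftrightarrow>
     (\<exists>S. finite S \<and> S \<subseteq> carrier G \<and> (\<forall>H. submonoid H G \<and> S \<subseteq> H \<longrightarrow> H = carrier G))"

definition nat_add_monoid :: "nat monoid" where
  "nat_add_monoid = \<lparr>carrier = UNIV, monoid.mult = (+), one = 0\<rparr>"

text \<open>The monomial \<open>x\<^sup>\<alpha>\<close> is represented by its exponent vector \<open>\<alpha>\<close>, a function on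
  \<^term>\<open>{..<n}\<close>. Multiplying monomials adds the exponents. Despite its name,
  \<^const>\<open>product_group\<close> is the componentwise product of arbitrary monoids.\<close>

definition Mon :: "nat \<Rightarrow> (nat \<Rightarrow> nat) monoid" where
  "Mon n = product_group {..<n} (\<lambda>_. nat_add_monoid)"

definition Zn :: "nat \<Rightarrow> (nat \<Rightarrow> int) monoid" where
  "Zn n = product_group {..<n} (\<lambda>_. integer_group)"

lemma comm_monoid_Mon: "comm_monoid (Mon n)"
  by (rule comm_monoidI)
     (auto simp: Mon_def nat_add_monoid_def PiE_iff extensional_def fun_eq_iff)

lemma comm_monoid_Zn: "comm_monoid (Zn n)"
  by (rule comm_monoidI)
     (auto simp: Zn_def integer_group_def PiE_iff extensional_def fun_eq_iff)


section \<open>Irreducibility, spectral spaces and dimension\<close>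

definition irreducible_space :: "'a topology \<Rightarrow> bool" where
  "irreducible_space X \<longleftrightarrow>
     topspace X \<noteq> {} \<and>
     (\<forall>A B. closedin X A \<and> closedin X B \<and> A \<union> B = topspace X \<longrightarrow>
            A = topspace X \<or> B = topspace X)"

definition irreducible_closedin :: "'a topology \<Rightarrow> 'a set \<Rightarrow> bool" where
  "irreducible_closedin X C \<longleftrightarrow> closedin X C \<and> irreducible_space (subtopology X C)"

definition sober_space :: "'a topology \<Rightarrow> bool" where
  "sober_space X \<longleftrightarrow>
     (\<forall>C. irreducible_closedin X C \<longrightarrow> (\<exists>!x. x \<in> topspace X \<and> X closure_of {x} = C))"

definition spectral_space :: "'a topology \<Rightarrow> bool" where
  "spectral_space X \<longleftrightarrow>
     compact_space X \<and> t0_space X \<and> sober_space X \<and>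
     (\<forall>U V. openin X U \<and> compactin X U \<and> openin X V \<and> compactin X V \<longrightarrow> compactin X (U \<inter> V)) \<and>
     openin X = arbitrary union_of (\<lambda>U. openin X U \<and> compactin X U)"

definition td_space :: "'a topology \<Rightarrow> bool" where
  "td_space X \<longleftrightarrow>
     (\<forall>x\<in>topspace X. openin (subtopology X (X closure_of {x})) {x})"

definition noetherian_space :: "'a topology \<Rightarrow> bool" where
  "noetherian_space X \<longleftrightarrow>
     (\<forall>C :: nat \<Rightarrow> 'a set. (\<forall>i. closedin X (C i)) \<and> decseq C \<longrightarrow> (\<exists>N. \<forall>i\<ge>N. C i = C N))"

text \<open>A chain \<open>C\<^sub>0 \<supset> \<dots> \<supset> C\<^sub>k\<close> is represented by the set of its \<open>k + 1\<close> members, which is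
  totally ordered by inclusion; its length is \<open>k\<close>.\<close>

definition chain_length :: "'a set set \<Rightarrow> enat" where
  "chain_length \<C> = (if finite \<C> then enat (card \<C> - 1) else \<infinity>)"

definition krull_dim :: "'a topology \<Rightarrow> enat" where
  "krull_dim X =
     (SUP \<C>\<in>{\<C>. finite \<C> \<and> \<C> \<noteq> {} \<and> subset.chain {C. irreducible_closedin X C} \<C>}.
        chain_length \<C>)"

definition pure_dimensional :: "'a topology \<Rightarrow> bool" where
  "pure_dimensional X \<longleftrightarrow>
     (\<forall>\<C> \<D>. subset.maxchain {C. irreducible_closedin X C} \<C> \<and>
            subset.maxchain {C. irreducible_closedin X C} \<D> \<longrightarrow>
            chain_length \<C> = chain_length \<D>)"

end

theory Submission
  imports Defs "HOL-Analysis.Function_Topology" "HOL-Analysis.Continuum_Not_Denumerable"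
    "HOL-Algebra.FiniteProduct"
begin

text \<open>By totality the subbasic open sets are the sets \<open>{r. (u, v) \<in> r}\<close>, so the closure of a point
  \<open>r\<close> is the set of its refinements \<open>s \<subseteq> r\<close>, and the trivial preorder is a generic point of the
  whole space. The topology is coarser than the one induced from the compact cube of all relations,
  in which the subbasic sets are clopen; compactness arguments there give spectrality. Irreducible
  closed sets thus correspond to preorders, and dimensions are read off chains of refinements. Since
  a proper refinement has a strictly smaller indifference congruence, the property \<open>T\<^sub>D\<close> is Redei's
  theorem that congruences on finitely generated commutative monoids are finitely generated.
  On the integer lattice the vectors indifferent to \<open>0\<close> form a subgroup with torsion-free quotient,
  whose rank drops strictly under proper refinement.\<close>


section \<open>Basic open sets and closures of points\<close>

text \<open>Soberness has to overcome that a union of preorders is in general not transitive;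
  irreducibility repairs this by placing any finitely many pairs of the union in a single member.
  What separates \<open>Mon n\<close> from \<open>Zn n\<close> is cancellation. On monomials all
  large exponents can be identified with one another, with a bound as high as desired, and this
  gives unbounded chains. On a group, \<open>u <= v\<close> means \<open>0 <= v - u\<close>, and
  \<open>0 <= c f\<close> with \<open>c > 0\<close> forces \<open>0 <= f\<close>, so that ranks can
  be counted. Finite dimension does not give the Noetherian property: chains of irreducible closed
  sets in the space of \<open>Zn n\<close> have at most \<open>n + 1\<close> members, so an infinite
  descent must pass through reducible closed sets. For \<open>n >= 2\<close> two simultaneous strict
  inequalities provide one.\<close>

definition basic_open :: "('a, 'b) monoid_scheme \<Rightarrow> 'a rel \<Rightarrow> 'a rel set" where
  "basic_open G F = {r \<in> monoid_preorders G. F \<subseteq> r}"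

definition preorders_below :: "('a, 'b) monoid_scheme \<Rightarrow> 'a rel \<Rightarrow> 'a rel set" where
  "preorders_below G r = {s \<in> monoid_preorders G. s \<subseteq> r}"

text \<open>Reflexivity is the case \<open>u = v\<close> of the disjunctive form of totality. In
  this shape every clause is universally quantified over conditions on a few single pairs, as the
  topology of the cube requires.\<close>

lemma monoid_preorders_iff:
  "r \<in> monoid_preorders G \<longleftrightarrow>
     r \<subseteq> carrier G \<times> carrier G \<and>
     (\<forall>u\<in>carrier G. \<forall>v\<in>carrier G. (u, v) \<in> r \<or> (v, u) \<in> r) \<and>
     (\<forall>u v w. (u, v) \<in> r \<longrightarrow> (v, w) \<in> r \<longrightarrow> (u, w) \<in> r) \<and>
     (\<forall>u\<in>carrier G. \<forall>v\<in>carrier G. \<forall>w\<in>carrier G.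
        (v, w) \<in> r \<longrightarrow> (u \<otimes>\<^bsub>G\<^esub> v, u \<otimes>\<^bsub>G\<^esub> w) \<in> r)"
proof -
  have "refl_on (carrier G) r \<and> total_on (carrier G) r \<longleftrightarrow>
      (\<forall>u\<in>carrier G. \<forall>v\<in>carrier G. (u, v) \<in> r \<or> (v, u) \<in> r)"
    unfolding refl_on_def total_on_def by metis
  then show ?thesis
    unfolding monoid_preorders_def preorder_on_def trans_def by simp argo
qed

lemma monoid_preorders_total:
  "r \<in> monoid_preorders G \<Longrightarrow> u \<in> carrier G \<Longrightarrow> v \<in> carrier G \<Longrightarrow> (u, v) \<notin> r \<Longrightarrow> (v, u) \<in> r"
  by (auto simp: monoid_preorders_iff)

lemma top_preorder:
  assumes "comm_monoid G"
  shows "carrier G \<times> carrier G \<in> monoid_preorders G"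
proof -
  interpret comm_monoid G by fact
  show ?thesis by (auto simp: monoid_preorders_iff)
qed

lemma complement_strictly_below:
  assumes "u \<in> carrier G" "v \<in> carrier G"
  shows "monoid_preorders G - {r \<in> monoid_preorders G. strictly_below r u v} = basic_open G {(v, u)}"
  using monoid_preorders_total[OF _ assms] by (auto simp: strictly_below_def basic_open_def)

lemma preorder_space_alt:
  "preorder_space G = topology_generated_by
     (insert (monoid_preorders G) ((\<lambda>p. basic_open G {p}) ` (carrier G \<times> carrier G)))"
proof -
  have "{monoid_preorders G - {r \<in> monoid_preorders G. strictly_below r u v} | u v.
            u \<in> carrier G \<and> v \<in> carrier G} =
        {basic_open G {(v, u)} | u v. u \<in> carrier G \<and> v \<in> carrier G}"
  proof (intro Collect_cong ex_cong1)
    fix A u v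
    show "(A = monoid_preorders G - {r \<in> monoid_preorders G. strictly_below r u v} \<and>
            u \<in> carrier G \<and> v \<in> carrier G) \<longleftrightarrow>
        (A = basic_open G {(v, u)} \<and> u \<in> carrier G \<and> v \<in> carrier G)"
      using complement_strictly_below[of u G v] by argo
  qed
  also have "\<dots> = (\<lambda>p. basic_open G {p}) ` (carrier G \<times> carrier G)" by blast
  finally show ?thesis by (simp add: preorder_space_def)
qed

lemma openin_basic_open:
  assumes "finite F"
  shows "openin (preorder_space G) (basic_open G F)"
  using assms
proof (induction F)
  case empty
  have "basic_open G {} = topspace (preorder_space G)" by (auto simp: basic_open_def)
  then show ?case by (metis openin_topspace)
next
  case (insert p F)
  have *: "basic_open G (insert p F) = basic_open G {p} \<inter> basic_open G F"
    by (auto simp: basic_open_def)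
  have "openin (preorder_space G) (basic_open G {p})"
  proof (cases "p \<in> carrier G \<times> carrier G")
    case True
    then show ?thesis unfolding preorder_space_alt by (intro topology_generated_by_Basis) blast
  next
    case False
    then have "basic_open G {p} = {}" by (auto simp: basic_open_def monoid_preorders_iff)
    then show ?thesis by simp
  qed
  with insert.IH show ?case unfolding * by (rule openin_Int[rotated])
qed

lemma openin_preorder_space_base:
  assumes "openin (preorder_space G) U" "r \<in> U"
  obtains F where "finite F" "F \<subseteq> r" "basic_open G F \<subseteq> U"
proof -
  have "generate_topology_on
     (insert (monoid_preorders G) ((\<lambda>p. basic_open G {p}) ` (carrier G \<times> carrier G))) U"
    using assms(1) unfolding preorder_space_alt by (simp add: openin_topology_generated_by_iff)
  then have "\<forall>r\<in>U. \<exists>F. finite F \<and> F \<subseteq> r \<and> basic_open G F \<subseteq> U"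
  proof induction
    case Empty
    then show ?case by simp
  next
    case (Int a b)
    show ?case
    proof
      fix r assume "r \<in> a \<inter> b"
      with Int obtain F E where "finite F" "F \<subseteq> r" "basic_open G F \<subseteq> a"
        "finite E" "E \<subseteq> r" "basic_open G E \<subseteq> b" by (meson IntE)
      then show "\<exists>F. finite F \<and> F \<subseteq> r \<and> basic_open G F \<subseteq> a \<inter> b"
        by (intro exI[of _ "F \<union> E"]) (auto simp: basic_open_def)
    qed
  next
    case (UN K)
    then show ?case by (meson Sup_upper2 UnionE)
  next
    case (Basis s)
    show ?case
    proof (cases "s = monoid_preorders G")
      case True
      then show ?thesis by (intro ballI exI[of _ "{}"]) (auto simp: basic_open_def)
    next
      case False
      with Basis obtain p where "s = basic_open G {p}" by auto
      then show ?thesis by (intro ballI exI[of _ "{p}"]) (auto simp: basic_open_def)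
    qed
  qed
  with assms(2) that show ?thesis by blast
qed

text \<open>A finite \<open>F\<close> that describes a neighbourhood of \<open>s\<close> lies in
  every \<open>r\<close> containing \<open>s\<close>; conversely, the neighbourhoods given by one
  pair of \<open>s\<close> each force that pair into \<open>r\<close>.\<close>

lemma closure_of_preorder:
  assumes "r \<in> monoid_preorders G"
  shows "preorder_space G closure_of {r} = preorders_below G r"
proof (intro equalityI subsetI)
  fix s assume "s \<in> preorder_space G closure_of {r}"
  then have s: "s \<in> monoid_preorders G"
    and *: "\<And>T. s \<in> T \<Longrightarrow> openin (preorder_space G) T \<Longrightarrow> r \<in> T"
    unfolding in_closure_of by (simp, blast)
  have "p \<in> r" if "p \<in> s" for p
    using *[OF _ openin_basic_open[of "{p}"]] that s by (auto simp: basic_open_def)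
  with s show "s \<in> preorders_below G r" by (auto simp: preorders_below_def)
next
  fix s assume s: "s \<in> preorders_below G r"
  have "r \<in> T" if T: "s \<in> T" "openin (preorder_space G) T" for T
  proof -
    obtain F where "F \<subseteq> s" "basic_open G F \<subseteq> T"
      using openin_preorder_space_base[OF T(2,1)] .
    with s assms show ?thesis by (auto simp: basic_open_def preorders_below_def)
  qed
  with s show "s \<in> preorder_space G closure_of {r}"
    unfolding in_closure_of by (simp add: preorders_below_def)
qed

section \<open>Spectrality\<close>

text \<open>Relations are regarded as points of the Cantor cube \<open>'a \<times> 'a \<Rightarrow> bool\<close>, where preorders
  form a closed, hence compact, set.\<close>

definition preorder_cube :: "('a, 'b) monoid_scheme \<Rightarrow> ('a \<times> 'a \<Rightarrow> bool) set" where
  "preorder_cube G = {f. Collect f \<in> monoid_preorders G}"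

lemma open_cube_coordinate: "open {f :: 'c \<Rightarrow> bool. f p}"
  and closed_cube_coordinate: "closed {f :: 'c \<Rightarrow> bool. f p}"
proof -
  have *: "{f :: 'c \<Rightarrow> bool. f p} = (\<lambda>f. f p) -` {True}" by auto
  have c: "continuous_on UNIV (\<lambda>f :: 'c \<Rightarrow> bool. f p)"
    by (rule continuous_on_product_coordinates)
  show "open {f :: 'c \<Rightarrow> bool. f p}" unfolding *
    by (rule open_vimage[OF open_discrete c])
  show "closed {f :: 'c \<Rightarrow> bool. f p}" unfolding *
    by (rule closed_vimage[OF _ c]) simp
qed

lemma compact_cube: "compact (UNIV :: ('c \<Rightarrow> bool) set)"
proof -
  have "compact_space (product_topology (\<lambda>_::'c. euclidean :: bool topology) UNIV)"
    unfolding compact_space_product_topology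
    by (simp add: compact_space_def finite_imp_compact)
  then show ?thesis
    by (metis compact_space_def compactin_euclidean_iff euclidean_product_topology topspace_euclidean)
qed

text \<open>Each clause of \<open>monoid_preorders_iff\<close> involves at most three coordinates,
  so it cuts out a clopen set; the quantifiers only intersect such sets.\<close>

lemma closed_preorder_cube: "closed (preorder_cube G)"
  unfolding preorder_cube_def monoid_preorders_iff subset_iff Ball_def mem_Collect_eq
  by (intro closed_Collect_all closed_Collect_conj closed_Collect_disj closed_Collect_imp
        open_cube_coordinate closed_cube_coordinate) auto

lemma continuous_preorder_cube:
  "continuous_map (top_of_set (preorder_cube G)) (preorder_space G) Collect"
  unfolding preorder_space_alt
proof (rule continuous_on_generated_topo)
  show "Collect ` topspace (top_of_set (preorder_cube G)) \<subseteq>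
      \<Union>(insert (monoid_preorders G) ((\<lambda>p. basic_open G {p}) ` (carrier G \<times> carrier G)))"
    by (auto simp: preorder_cube_def)
next
  fix U assume "U \<in> insert (monoid_preorders G) ((\<lambda>p. basic_open G {p}) ` (carrier G \<times> carrier G))"
  then consider "U = monoid_preorders G" | p where "U = basic_open G {p}" by auto
  then show "openin (top_of_set (preorder_cube G))
      (Collect -` U \<inter> topspace (top_of_set (preorder_cube G)))"
  proof cases
    case 1
    then have "Collect -` U \<inter> topspace (top_of_set (preorder_cube G)) = preorder_cube G"
      by (auto simp: preorder_cube_def)
    then show ?thesis by simp
  next
    case 2
    then have "Collect -` U \<inter> topspace (top_of_set (preorder_cube G)) =
        preorder_cube G \<inter> {f. f p}"
      by (auto simp: preorder_cube_def basic_open_def)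
    then show ?thesis using open_cube_coordinate by (metis openin_open_Int)
  qed
qed

text \<open>\<open>F\<close> may be infinite: the conditions are closed in the cube, so any number
  of them leaves a compact set, and compactness passes to the image in the coarser topology.\<close>

lemma compactin_basic_open: "compactin (preorder_space G) (basic_open G F)"
proof -
  let ?K = "preorder_cube G \<inter> (\<Inter>p\<in>F. {f. f p})"
  have "closed ?K" by (intro closed_Int closed_INT closed_preorder_cube ballI closed_cube_coordinate)
  then have "compact ?K" using compact_cube by (metis compact_Int_closed Int_UNIV_left)
  then have "compactin (top_of_set (preorder_cube G)) ?K" by (simp add: compactin_subtopology)
  then have "compactin (preorder_space G) (Collect ` ?K)"
    by (rule image_compactin[OF _ continuous_preorder_cube])
  moreover have "Collect ` ?K = basic_open G F"
  proof (intro equalityI subsetI)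
    fix r assume "r \<in> basic_open G F"
    then have "(\<lambda>p. p \<in> r) \<in> ?K" by (auto simp: basic_open_def preorder_cube_def)
    then show "r \<in> Collect ` ?K" by (rule rev_image_eqI) simp
  qed (auto simp: basic_open_def preorder_cube_def)
  ultimately show ?thesis by simp
qed

text \<open>Reduces the intersection of two compact open sets to intersections of basic ones, where
  the sets for \<open>F\<close> and \<open>E\<close> meet in the set for their union.\<close>

lemma compact_open_preorder_space:
  assumes "openin (preorder_space G) U" "compactin (preorder_space G) U"
  obtains \<F> where "finite \<F>" "\<And>F. F \<in> \<F> \<Longrightarrow> finite F" "U = (\<Union>F\<in>\<F>. basic_open G F)"
proof -
  let ?B = "basic_open G ` {F. finite F \<and> basic_open G F \<subseteq> U}"
  have "U \<subseteq> \<Union>?B"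
  proof
    fix r assume r: "r \<in> U"
    obtain F where "finite F" "F \<subseteq> r" "basic_open G F \<subseteq> U"
      using openin_preorder_space_base[OF assms(1) r] .
    moreover have "r \<in> monoid_preorders G" using r openin_subset[OF assms(1)] by auto
    ultimately show "r \<in> \<Union>?B" by (auto simp: basic_open_def)
  qed
  moreover have "\<And>B. B \<in> ?B \<Longrightarrow> openin (preorder_space G) B" using openin_basic_open by blast
  ultimately obtain \<B> where \<B>: "finite \<B>" "\<B> \<subseteq> ?B" "U \<subseteq> \<Union>\<B>"
    using compactinD[OF assms(2), of ?B] by blast
  then obtain \<F> where "\<F> \<subseteq> {F. finite F \<and> basic_open G F \<subseteq> U}" "finite \<F>" "\<B> = basic_open G ` \<F>"
    by (meson finite_subset_image)
  with \<B> show ?thesis by (intro that[of \<F>]) auto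
qed

lemma closedin_preorders_below:
  "r \<in> monoid_preorders G \<Longrightarrow> closedin (preorder_space G) (preorders_below G r)"
  by (metis closedin_closure_of closure_of_preorder)

lemma closedin_preorder_space_down:
  assumes "closedin (preorder_space G) C" "r \<in> C" "s \<in> monoid_preorders G" "s \<subseteq> r"
  shows "s \<in> C"
proof -
  have r: "r \<in> monoid_preorders G" using assms(2) closedin_subset[OF assms(1)] by auto
  have "preorder_space G closure_of {r} \<subseteq> C" using assms by (simp add: closure_of_minimal)
  then show ?thesis using assms by (auto simp: closure_of_preorder[OF r] preorders_below_def)
qed

text \<open>Of two closed sets covering it, one contains \<open>r\<close>; closed sets are stable
  under refinement, so that one is everything.\<close>

lemma irreducible_closedin_preorders_below:
  assumes r: "r \<in> monoid_preorders G"
  shows "irreducible_closedin (preorder_space G) (preorders_below G r)"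
proof -
  let ?C = "preorders_below G r"
  have c: "closedin (preorder_space G) ?C" by (rule closedin_preorders_below[OF r])
  have sub: "?C \<subseteq> monoid_preorders G" and mem: "r \<in> ?C" using r by (auto simp: preorders_below_def)
  have "A = ?C" if "closedin (subtopology (preorder_space G) ?C) A" "r \<in> A" for A
  proof -
    have "closedin (preorder_space G) A" "A \<subseteq> ?C"
      using that(1) c by (auto simp: closedin_closed_subtopology)
    then show ?thesis using closedin_preorder_space_down[OF _ that(2)]
      by (auto simp: preorders_below_def)
  qed
  moreover have "topspace (subtopology (preorder_space G) ?C) = ?C"
    using sub by auto
  ultimately show ?thesis using c mem unfolding irreducible_closedin_def irreducible_space_def
    by (metis UnE empty_iff)
qed

text \<open>The generic point of an irreducible closed set is the union of its elements. That this union
  belongs to the set is the finite intersection property in the Cantor cube.\<close>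

lemma irreducible_closedin_generic:
  assumes "irreducible_closedin (preorder_space G) C"
  obtains r where "r \<in> monoid_preorders G" "C = preorders_below G r"
proof -
  have c: "closedin (preorder_space G) C"
    and irr: "irreducible_space (subtopology (preorder_space G) C)"
    using assms by (auto simp: irreducible_closedin_def)
  have sub: "C \<subseteq> monoid_preorders G" using closedin_subset[OF c] by simp
  then have ts: "topspace (subtopology (preorder_space G) C) = C" by auto
  have ne: "C \<noteq> {}" using irr by (auto simp: irreducible_space_def ts)
  have meet: "C \<inter> U \<inter> V \<noteq> {}" if "openin (preorder_space G) U" "openin (preorder_space G) V"
      "C \<inter> U \<noteq> {}" "C \<inter> V \<noteq> {}" for U V
  proof
    assume "C \<inter> U \<inter> V = {}"
    then have "(C - U) \<union> (C - V) = C" by blast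
    moreover have "closedin (subtopology (preorder_space G) C) (C - U)"
        "closedin (subtopology (preorder_space G) C) (C - V)"
      using that c by (auto simp: closedin_closed_subtopology intro!: closedin_diff)
    ultimately have "C - U = C \<or> C - V = C"
      using irr unfolding irreducible_space_def ts by blast
    with that(3,4) show False by blast
  qed
  \<comment> \<open>Finitely many pairs taken from different members of \<open>C\<close> occur
    together in one member: the relatively open sets belonging to the single pairs are nonempty, and
    by \<open>meet\<close> such sets intersect.\<close>
  have fin: "C \<inter> basic_open G F \<noteq> {}" if "finite F" "F \<subseteq> \<Union>C" for F
    using that
  proof induction
    case empty
    with ne sub show ?case by (auto simp: basic_open_def)
  next
    case (insert p F)
    then obtain s where "s \<in> C" "p \<in> s" by auto
    then have "C \<inter> basic_open G {p} \<noteq> {}" using sub by (auto simp: basic_open_def)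
    then have "C \<inter> basic_open G {p} \<inter> basic_open G F \<noteq> {}"
      using insert by (intro meet openin_basic_open) auto
    then show ?case by (auto simp: basic_open_def)
  qed
  let ?K = "{f. Collect f \<in> C}"
  have "?K \<subseteq> preorder_cube G" using sub by (auto simp: preorder_cube_def)
  then have "?K = {f \<in> topspace (top_of_set (preorder_cube G)). Collect f \<in> C}" by auto
  then have "closedin (top_of_set (preorder_cube G)) ?K"
    using closedin_continuous_map_preimage[OF continuous_preorder_cube c] by simp
  then have "closed ?K" using closed_preorder_cube closedin_closed_eq by blast
  then have "compact ?K" using compact_cube by (metis compact_Int_closed Int_UNIV_left)
  moreover have "\<And>T. T \<in> (\<lambda>p. {f. f p}) ` \<Union>C \<Longrightarrow> closed T"
    using closed_cube_coordinate by fast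
  moreover have "?K \<inter> \<Inter>\<F> \<noteq> {}" if fF: "finite \<F>" "\<F> \<subseteq> (\<lambda>p. {f. f p}) ` \<Union>C" for \<F>
  proof -
    obtain F where F: "finite F" "F \<subseteq> \<Union>C" "\<F> = (\<lambda>p. {f. f p}) ` F"
      using finite_subset_image[OF fF] by blast
    then obtain s where "s \<in> C" "F \<subseteq> s" using fin[OF F(1,2)] by (auto simp: basic_open_def)
    then have "(\<lambda>p. p \<in> s) \<in> ?K \<inter> \<Inter>\<F>" using F by auto
    then show ?thesis by blast
  qed
  ultimately have "?K \<inter> \<Inter>((\<lambda>p. {f. f p}) ` \<Union>C) \<noteq> {}" by (rule compact_imp_fip) 
  then obtain f where f: "Collect f \<in> C" "\<Union>C \<subseteq> Collect f" by auto
  \<comment> \<open>The member found contains every other member, so it is the union of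
    \<open>C\<close> and its refinements exhaust \<open>C\<close>.\<close>
  then have "C = preorders_below G (Collect f)"
    using sub closedin_preorder_space_down[OF c f(1)] by (auto simp: preorders_below_def)
  with f sub that show ?thesis by blast
qed

lemma preorders_below_subset_iff:
  "r \<in> monoid_preorders G \<Longrightarrow> preorders_below G r \<subseteq> preorders_below G s \<longleftrightarrow> r \<subseteq> s"
  by (auto simp: preorders_below_def)

lemma inj_on_preorders_below: "inj_on (preorders_below G) (monoid_preorders G)"
  by (rule inj_onI) (metis preorders_below_subset_iff subset_antisym subset_refl)

lemma irreducible_closedin_preorder_space:
  "{C. irreducible_closedin (preorder_space G) C} = preorders_below G ` monoid_preorders G"
  using irreducible_closedin_preorders_below irreducible_closedin_generic by blast

lemma t0_preorder_space: "t0_space (preorder_space G)"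
  unfolding t0_space_def
proof (intro ballI impI)
  fix r s assume rs: "r \<in> topspace (preorder_space G)" "s \<in> topspace (preorder_space G)" "r \<noteq> s"
  then obtain p where "(p \<in> r) \<noteq> (p \<in> s)" by blast
  with rs show "\<exists>U. openin (preorder_space G) U \<and> (r \<notin> U) = (s \<in> U)"
    by (intro exI[of _ "basic_open G {p}"]) (auto simp: openin_basic_open, auto simp: basic_open_def)
qed

lemma sober_preorder_space: "sober_space (preorder_space G)"
  unfolding sober_space_def
proof (intro allI impI)
  fix C assume "irreducible_closedin (preorder_space G) C"
  then obtain r where "r \<in> monoid_preorders G" "C = preorders_below G r"
    by (rule irreducible_closedin_generic)
  then show "\<exists>!x. x \<in> topspace (preorder_space G) \<and> preorder_space G closure_of {x} = C"
    by (intro ex1I[of _ r])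
      (auto simp: closure_of_preorder inj_on_eq_iff[OF inj_on_preorders_below])
qed

lemma spectral_preorder_space: "spectral_space (preorder_space G)"
proof -
  have "basic_open G {} = monoid_preorders G" by (auto simp: basic_open_def)
  then have "compact_space (preorder_space G)"
    using compactin_basic_open[of G "{}"] by (simp add: compact_space_def)
  moreover have "compactin (preorder_space G) (U \<inter> V)"
    if UV: "openin (preorder_space G) U" "compactin (preorder_space G) U"
       "openin (preorder_space G) V" "compactin (preorder_space G) V" for U V
  proof -
    obtain \<F> where \<F>: "finite \<F>" "U = (\<Union>F\<in>\<F>. basic_open G F)"
      using compact_open_preorder_space[OF UV(1,2)] by metis
    obtain \<E> where \<E>: "finite \<E>" "V = (\<Union>F\<in>\<E>. basic_open G F)"
      using compact_open_preorder_space[OF UV(3,4)] by metis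
    have "U \<inter> V = (\<Union>(F, E)\<in>\<F> \<times> \<E>. basic_open G (F \<union> E))"
      unfolding \<F> \<E> by (auto simp: basic_open_def)
    also have "compactin (preorder_space G) \<dots>"
      using \<F> \<E> by (intro compactin_Union) (auto simp: compactin_basic_open)
    finally show ?thesis .
  qed
  moreover have "openin (preorder_space G) =
      arbitrary union_of (\<lambda>U. openin (preorder_space G) U \<and> compactin (preorder_space G) U)"
    unfolding openin_topology_base_unique
  proof (intro conjI allI impI)
    fix U r assume "openin (preorder_space G) U \<and> r \<in> U"
    then have U: "openin (preorder_space G) U" "r \<in> U" by auto
    obtain F where "finite F" "F \<subseteq> r" "basic_open G F \<subseteq> U"
      using openin_preorder_space_base[OF U] .
    moreover have "r \<in> monoid_preorders G" using U openin_subset by fastforce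
    ultimately show "\<exists>B. (openin (preorder_space G) B \<and> compactin (preorder_space G) B) \<and>
        r \<in> B \<and> B \<subseteq> U"
      by (intro exI[of _ "basic_open G F"])
        (auto simp: openin_basic_open compactin_basic_open, auto simp: basic_open_def)
  qed auto
  ultimately show ?thesis unfolding spectral_space_def
    using t0_preorder_space sober_preorder_space by blast
qed

lemma irreducible_preorder_space:
  assumes "comm_monoid G"
  shows "irreducible_space (preorder_space G)"
proof -
  have "preorders_below G (carrier G \<times> carrier G) = topspace (preorder_space G)"
    by (auto simp: preorders_below_def monoid_preorders_def preorder_on_def)
  then show ?thesis
    using irreducible_closedin_preorders_below[OF top_preorder[OF assms]]
    by (metis irreducible_closedin_def subtopology_topspace)
qed

section \<open>Finitely generated monoids\<close>

lemma nat_seq_incseq_subseq: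
  fixes f :: "nat \<Rightarrow> nat"
  obtains h :: "nat \<Rightarrow> nat" where "strict_mono h" "incseq (\<lambda>k. f (h k))"
proof -
  obtain h where h: "strict_mono h" "monoseq (\<lambda>k. f (h k))" using seq_monosub by blast
  show ?thesis
  proof (cases "incseq (\<lambda>k. f (h k))")
    case True
    with h that show ?thesis by blast
  next
    case False
    with h have dec: "decseq (\<lambda>k. f (h k))" by (simp add: monoseq_iff)
    \<comment> \<open>A decreasing sequence of naturals is constant from the index at which it
      attains its minimum, so its tail is also increasing.\<close>
    define N where "N = (LEAST y. \<exists>k. y = f (h k))"
    have "\<exists>k. N = f (h k)" unfolding N_def by (rule LeastI) (rule exI, rule refl)
    then obtain k0 where k0: "N = f (h k0)" by blast
    have "N \<le> f (h k)" for k unfolding N_def by (rule Least_le) blast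
    then have "f (h k) = N" if "k \<ge> k0" for k using decseqD[OF dec that] k0 by (simp add: le_antisym)
    then have "incseq (\<lambda>k. f (h (k + k0)))" by (simp add: incseq_def)
    moreover have "strict_mono (\<lambda>k. h (k + k0))" using h(1) by (simp add: strict_mono_def)
    ultimately show ?thesis by (rule that[rotated])
  qed
qed

lemma nat_vector_seq_incseq_subseq:
  fixes f :: "nat \<Rightarrow> nat \<Rightarrow> nat"
  shows "\<exists>h :: nat \<Rightarrow> nat. strict_mono h \<and> (\<forall>i<m. incseq (\<lambda>k. f (h k) i))"
proof (induction m)
  case 0
  show ?case by (rule exI[of _ id]) (simp add: strict_mono_def)
next
  case (Suc m)
  then obtain h where h: "strict_mono h" "\<forall>i<m. incseq (\<lambda>k. f (h k) i)" by blast
  obtain g where g: "strict_mono g" "incseq (\<lambda>k. f (h (g k)) m)"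
    using nat_seq_incseq_subseq[of "\<lambda>k. f (h k) m"] by blast
  have "strict_mono (h \<circ> g)" using h(1) g(1) by (rule strict_mono_o)
  moreover have "incseq (\<lambda>k. f ((h \<circ> g) k) i)" if "i < Suc m" for i
  proof (cases "i = m")
    case False
    then have "incseq (\<lambda>k. f (h k) i)" using that h(2) by simp
    then show ?thesis using g(1) by (auto simp: incseq_def strict_mono_less_eq)
  qed (use g in simp)
  ultimately show ?case by blast
qed

text \<open>\<open>B\<close> consists of the componentwise minimal vectors of \<open>A\<close>. Were
  it infinite, thinning an injective sequence one coordinate at a time would make two distinct
  minimal vectors comparable. Descent on the coordinate sum finds a minimal vector below any given
  one.\<close>

lemma Dickson:
  fixes A :: "(nat \<Rightarrow> nat) set"
  assumes A: "\<And>a i. a \<in> A \<Longrightarrow> i \<ge> m \<Longrightarrow> a i = 0"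
  obtains B where "finite B" "B \<subseteq> A" "\<And>a. a \<in> A \<Longrightarrow> \<exists>b\<in>B. \<forall>i. b i \<le> a i"
proof -
  define B where "B = {b \<in> A. \<forall>a\<in>A. (\<forall>i. a i \<le> b i) \<longrightarrow> a = b}"
  have "finite B"
  proof (rule ccontr)
    assume "infinite B"
    then obtain f :: "nat \<Rightarrow> nat \<Rightarrow> nat" where f: "inj f" "range f \<subseteq> B"
      using infinite_countable_subset by blast
    obtain h :: "nat \<Rightarrow> nat" where h: "strict_mono h" "\<forall>i<m. incseq (\<lambda>k. f (h k) i)"
      using nat_vector_seq_incseq_subseq by blast
    have mem: "f k \<in> A" for k using f(2) by (auto simp: B_def)
    have "f (h 0) i \<le> f (h 1) i" for i
      using h(2) A[OF mem, of i] by (cases "i < m") (auto simp: incseq_def)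
    then have "f (h 0) = f (h 1)" using f(2) mem by (auto simp: B_def)
    then have "h 0 = h 1" using f(1) by (simp add: inj_eq)
    then show False using h(1) by (simp add: strict_mono_eq)
  qed
  moreover have "\<exists>b\<in>B. \<forall>i. b i \<le> a i" if "a \<in> A" for a
    using that
  proof (induction "\<Sum>i<m. a i" arbitrary: a rule: less_induct)
    case less
    show ?case
    proof (cases "a \<in> B")
      case False
      then obtain c where c: "c \<in> A" "\<forall>i. c i \<le> a i" "c \<noteq> a" using less.prems by (auto simp: B_def)
      then obtain i where "c i \<noteq> a i" by (auto simp: fun_eq_iff)
      then have "i < m" "c i < a i" using A[of a i] A[of c i] c less.prems
        by (metis not_le_imp_less, metis le_neq_implies_less)
      then have "(\<Sum>i<m. c i) < (\<Sum>i<m. a i)" using c(2) by (intro sum_strict_mono_ex1) auto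
      then obtain b where "b \<in> B" "\<forall>i. b i \<le> c i" using less.hyps c(1) by blast
      with c(2) show ?thesis by (meson le_trans)
    qed blast
  qed
  moreover have "B \<subseteq> A" by (auto simp: B_def)
  ultimately show ?thesis using that by blast
qed

text \<open>A monomial order in the sense of Groebner bases: well-founded, total on vectors
  supported below \<open>m\<close>, and invariant under translation. The bound \<open>i < m\<close>
  matters, since the lexicographic order on infinite sequences has the infinite descent of the unit
  vectors.\<close>

definition lex_less :: "nat \<Rightarrow> (nat \<Rightarrow> nat) \<Rightarrow> (nat \<Rightarrow> nat) \<Rightarrow> bool" where
  "lex_less m a b \<longleftrightarrow> (\<exists>i<m. a i < b i \<and> (\<forall>j<i. a j = b j))"

lemma wf_lex_less: "wf {(a, b). lex_less m a b}"
proof (rule wf_subset)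
  show "wf (inv_image (lexn less_than m) (\<lambda>a. map a [0..<m]))"
    by (intro wf_inv_image wf_lexn wf_less_than)
  show "{(a, b). lex_less m a b} \<subseteq> inv_image (lexn less_than m) (\<lambda>a. map a [0..<m])"
  proof clarify
    fix a b assume "lex_less m a b"
    then obtain i where i: "i < m" "a i < b i" "\<forall>j<i. a j = b j" by (auto simp: lex_less_def)
    have split: "map c [0..<m] = map c [0..<i] @ c i # map c [Suc i..<m]" for c :: "nat \<Rightarrow> nat"
      using i(1) by (metis append.simps list.map map_append upt_add_eq_append le0 le_add_diff_inverse
          less_imp_le upt_conv_Cons)
    have "map b [0..<m] = map a [0..<i] @ b i # map b [Suc i..<m]"
      using split[of b] i(3) by simp
    then have "\<exists>xys x y xs ys. map a [0..<m] = xys @ x # xs \<and> map b [0..<m] = xys @ y # ys \<and>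
        (x, y) \<in> less_than"
      using split[of a] i(2) by (metis less_than_iff)
    then have "(map a [0..<m], map b [0..<m]) \<in> lexn less_than m"
      by (simp add: lexn_conv)
    then show "(a, b) \<in> inv_image (lexn less_than m) (\<lambda>a. map a [0..<m])" by simp
  qed
qed

lemma lex_less_total:
  assumes "\<And>i. i \<ge> m \<Longrightarrow> a i = 0" "\<And>i. i \<ge> m \<Longrightarrow> b i = 0" "a \<noteq> b"
  shows "lex_less m a b \<or> lex_less m b a"
proof -
  define i where "i = (LEAST i. a i \<noteq> b i)"
  have "\<exists>i. a i \<noteq> b i" using assms(3) by (auto simp: fun_eq_iff)
  then have i: "a i \<noteq> b i" unfolding i_def by (rule LeastI_ex)
  moreover have "a j = b j" if "j < i" for j using not_less_Least[of j "\<lambda>i. a i \<noteq> b i"] that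
    unfolding i_def by blast
  moreover have "i < m" using i assms(1,2) by (metis not_le_imp_less)
  ultimately show ?thesis unfolding lex_less_def by (metis linorder_neq_iff)
qed

section \<open>Presentation by exponent vectors, Redei's theorem and the property T_D\<close>

context comm_monoid
begin

text \<open>The homomorphism from the free commutative monoid of exponent vectors to
  \<open>G\<close> that sends the \<open>i\<close>-th unit vector to \<open>g i\<close>, for
  \<open>i < m\<close>.\<close>

definition monomial :: "nat \<Rightarrow> (nat \<Rightarrow> 'a) \<Rightarrow> (nat \<Rightarrow> nat) \<Rightarrow> 'a" where
  "monomial m g a = finprod G (\<lambda>i. g i [^] a i) {..<m}"

lemma monomial_closed:
  assumes "g ` {..<m} \<subseteq> carrier G"
  shows "monomial m g a \<in> carrier G"
  unfolding monomial_def using assms by (intro finprod_closed) auto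

lemma monomial_add:
  assumes "g ` {..<m} \<subseteq> carrier G"
  shows "monomial m g (\<lambda>i. a i + b i) = monomial m g a \<otimes> monomial m g b"
proof -
  have "monomial m g (\<lambda>i. a i + b i) = finprod G (\<lambda>i. g i [^] a i \<otimes> g i [^] b i) {..<m}"
    unfolding monomial_def using assms by (intro finprod_cong') (auto simp: nat_pow_mult)
  also have "\<dots> = monomial m g a \<otimes> monomial m g b"
    unfolding monomial_def using assms by (intro finprod_multf) auto
  finally show ?thesis .
qed

text \<open>The monomials in the generators form a submonoid containing them, and finite generation
  is defined by the absence of smaller such submonoids.\<close>

lemma finitely_generated_monomials:
  assumes "finitely_generated_monoid G"
  obtains m g where "g ` {..<m} \<subseteq> carrier G" "carrier G = monomial m g ` {a. \<forall>i\<ge>m. a i = 0}"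
proof -
  obtain S where S: "finite S" "S \<subseteq> carrier G"
      "\<And>H. submonoid H G \<Longrightarrow> S \<subseteq> H \<Longrightarrow> H = carrier G"
    using assms by (auto simp: finitely_generated_monoid_def)
  obtain m and g :: "nat \<Rightarrow> 'a" where "S = g ` {i. i < m}"
    using finite_imp_nat_seg_image_inj_on[OF S(1)] by blast
  then have Sg: "S = g ` {..<m}" by (simp add: lessThan_def)
  with S(2) have g: "g ` {..<m} \<subseteq> carrier G" by simp
  define H where "H = monomial m g ` {a. \<forall>i\<ge>m. a i = 0}"
  have "submonoid H G"
  proof
    show "H \<subseteq> carrier G" using monomial_closed[OF g] by (auto simp: H_def)
    show "x \<otimes> y \<in> H" if xy: "x \<in> H" "y \<in> H" for x y
    proof -
      obtain a b where "\<forall>i\<ge>m. a i = 0" "x = monomial m g a" "\<forall>i\<ge>m. b i = 0" "y = monomial m g b"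
        using xy by (auto simp: H_def)
      then show ?thesis unfolding H_def
        by (intro image_eqI[of _ _ "\<lambda>i. a i + b i"]) (auto simp: monomial_add[OF g])
    qed
    have "monomial m g (\<lambda>_. 0) = \<one>" by (simp add: monomial_def)
    then show "\<one> \<in> H" unfolding H_def by (intro image_eqI[of _ _ "\<lambda>_. 0"]) auto
  qed
  moreover have "S \<subseteq> H"
  proof
    fix x assume "x \<in> S"
    then obtain k where k: "k < m" "x = g k" using Sg by auto
    have "monomial m g (\<lambda>i. if i = k then 1 else 0) =
        finprod G (\<lambda>i. if k = i then g i else \<one>) {..<m}"
      unfolding monomial_def using g by (intro finprod_cong') (auto simp: image_subset_iff)
    also have "\<dots> = x" using k g by (subst finprod_singleton) auto
    finally show "x \<in> H" unfolding H_def using k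
      by (intro image_eqI[of _ _ "\<lambda>i. if i = k then 1 else 0"]) auto
  qed
  ultimately have "H = carrier G" by (rule S(3))
  then show ?thesis by (intro that[OF g]) (simp add: H_def)
qed

text \<open>Redei's theorem in the form needed here: the indifference congruence of \<open>r\<close> is finitely
  generated. The exponent vectors that are not lexicographically minimal in their class form an
  ideal. Rewriting the finitely many minimal generators of this ideal to smaller equivalent vectors
  brings every vector to the normal form of its class, as in a Groebner basis.\<close>

lemma finitely_generated_preorder:
  assumes fg: "finitely_generated_monoid G" and r: "r \<in> monoid_preorders G"
  obtains F where "finite F" "F \<subseteq> r" "\<forall>s\<in>monoid_preorders G. F \<subseteq> s \<longrightarrow> s \<subseteq> r \<longrightarrow> s = r"
proof -
  obtain m g where g: "g ` {..<m} \<subseteq> carrier G"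
    and surj: "carrier G = monomial m g ` {a. \<forall>i\<ge>m. a i = 0}"
    by (rule finitely_generated_monomials[OF fg])
  define ev where "ev = monomial m g"
  have ev: "ev a \<in> carrier G" "ev (\<lambda>i. a i + b i) = ev a \<otimes> ev b" for a b
    unfolding ev_def using g by (auto intro: monomial_closed monomial_add)
  define E :: "(nat \<Rightarrow> nat) set" where "E = {a. \<forall>i\<ge>m. a i = 0}"
  define eq where "eq s a b \<longleftrightarrow> (ev a, ev b) \<in> s \<and> (ev b, ev a) \<in> s" for s a b
  have eq_refl: "eq s a a" if "s \<in> monoid_preorders G" for s a
    using that ev(1) unfolding eq_def by (auto simp: monoid_preorders_iff)
  have eq_sym: "eq s a b \<Longrightarrow> eq s b a" for s a b unfolding eq_def by blast
  have eq_trans: "eq s a c" if "s \<in> monoid_preorders G" "eq s a b" "eq s b c" for s a b c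
    using that unfolding eq_def monoid_preorders_iff by meson
  have eq_add: "eq s (\<lambda>i. c i + a i) (\<lambda>i. c i + b i)" if "s \<in> monoid_preorders G" "eq s a b" for s a b c
    using that unfolding eq_def by (auto simp: monoid_preorders_iff ev)
  define I where "I = {a \<in> E. \<exists>b\<in>E. eq r a b \<and> lex_less m b a}"
  obtain B where B: "finite B" "B \<subseteq> I" "\<And>a. a \<in> I \<Longrightarrow> \<exists>b\<in>B. \<forall>i. b i \<le> a i"
    by (rule Dickson[of I m]) (auto simp: I_def E_def)
  have "\<forall>b\<in>B. \<exists>c. c \<in> E \<and> eq r b c \<and> lex_less m c b" using B(2) by (auto simp: I_def)
  then obtain h where h: "\<And>b. b \<in> B \<Longrightarrow> h b \<in> E \<and> eq r b (h b) \<and> lex_less m (h b) b" by metis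
  \<comment> \<open>Both directions of each rewriting pair are recorded, so that
    \<open>F \<subseteq> s\<close> makes \<open>b\<close> and \<open>h b\<close> indifferent for
    \<open>s\<close>, not merely comparable.\<close>
  define F where "F = (\<lambda>b. (ev b, ev (h b))) ` B \<union> (\<lambda>b. (ev (h b), ev b)) ` B"
  have "s = r" if s: "s \<in> monoid_preorders G" and F: "F \<subseteq> s" and sr: "s \<subseteq> r" for s
  proof -
    have normal_form: "\<exists>c\<in>E. c \<notin> I \<and> eq s a c" if "a \<in> E" for a
      using wf_lex_less[of m] that
    proof (induction a rule: wf_induct_rule)
      case (less a)
      show ?case
      proof (cases "a \<in> I")
        case False
        with less.prems eq_refl[OF s] show ?thesis by blast
      next
        case True
        then obtain b where b: "b \<in> B" "\<forall>i. b i \<le> a i" using B(3) by blast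
        define d where "d = (\<lambda>i. a i - b i)"
        define a' where "a' = (\<lambda>i. d i + h b i)"
        have a: "a = (\<lambda>i. d i + b i)" using b(2) by (simp add: d_def fun_eq_iff)
        have "eq s b (h b)" using F b(1) unfolding F_def eq_def by auto
        then have "eq s a a'" unfolding a a'_def by (rule eq_add[OF s])
        moreover have "a' \<in> E" using h[OF b(1)] less.prems by (auto simp: E_def a'_def d_def)
        moreover have "lex_less m a' a" using h[OF b(1)] unfolding a a'_def lex_less_def by auto
        ultimately show ?thesis using less.IH[of a'] eq_trans[OF s] by blast
      qed
    qed
    have eq_sub: "eq s a b" if ab: "a \<in> E" "b \<in> E" "eq r a b" for a b
    proof -
      obtain c d where c: "c \<in> E" "c \<notin> I" "eq s a c" and d: "d \<in> E" "d \<notin> I" "eq s b d"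
        using normal_form ab(1,2) by meson
      have "eq r a c" "eq r b d" using c d sr by (auto simp: eq_def)
      then have "eq r c d" using ab(3) eq_trans[OF r] eq_sym by meson
      \<comment> \<open>If one of the two normal forms were smaller, the other would lie in
        \<open>I\<close>. Hence \<open>a\<close> and \<open>b\<close> share a normal form, which
        both reach by indifferences of \<open>s\<close>.\<close>
      then have "\<not> lex_less m c d \<and> \<not> lex_less m d c" using c d eq_sym by (auto simp: I_def)
      then have "c = d" using lex_less_total[of m c d] c d by (auto simp: E_def)
      then show ?thesis using c d eq_trans[OF s] eq_sym by meson
    qed
    have ker: "(x, y) \<in> s" if xy: "(x, y) \<in> r" "(y, x) \<in> r" for x y
    proof -
      have "x \<in> carrier G" "y \<in> carrier G" using xy r by (auto simp: monoid_preorders_iff)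
      then obtain a b where "a \<in> E" "b \<in> E" "x = ev a" "y = ev b"
        using surj unfolding ev_def E_def by (auto simp del: mem_Collect_eq elim!: imageE)
      then show ?thesis using eq_sub xy by (auto simp: eq_def)
    qed
    \<comment> \<open>A pair of \<open>r\<close> missing from \<open>s\<close> occurs reversed in
      \<open>s\<close>, hence in \<open>r\<close>. It is therefore an indifference of
      \<open>r\<close>, and \<open>ker\<close> puts those into \<open>s\<close>.\<close>
    have "(x, y) \<in> s" if xy: "(x, y) \<in> r" for x y
    proof (rule ccontr)
      assume ns: "(x, y) \<notin> s"
      have "x \<in> carrier G" "y \<in> carrier G" using xy r by (auto simp: monoid_preorders_iff)
      then have "(y, x) \<in> s" using monoid_preorders_total[OF s _ _ ns] by blast
      then show False using ker xy sr ns by blast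
    qed
    with sr show ?thesis by auto
  qed
  moreover have "finite F" using B(1) by (simp add: F_def)
  moreover have "F \<subseteq> r" using h by (auto simp: F_def eq_def)
  ultimately show ?thesis using that by blast
qed

lemma td_preorder_space:
  assumes "finitely_generated_monoid G"
  shows "td_space (preorder_space G)"
  unfolding td_space_def
proof
  fix r assume "r \<in> topspace (preorder_space G)"
  then have r: "r \<in> monoid_preorders G" by simp
  obtain F where F: "finite F" "F \<subseteq> r"
      "\<forall>s\<in>monoid_preorders G. F \<subseteq> s \<longrightarrow> s \<subseteq> r \<longrightarrow> s = r"
    by (rule finitely_generated_preorder[OF assms r])
  have "{r} = preorders_below G r \<inter> basic_open G F"
    using F(2,3) r by (auto simp: preorders_below_def basic_open_def)
  then show "openin (subtopology (preorder_space G) (preorder_space G closure_of {r})) {r}"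
    unfolding closure_of_preorder[OF r] using openin_basic_open[OF F(1)]
    by (auto simp: openin_subtopology)
qed

end

section \<open>Chains of preorders\<close>

text \<open>Taking closures of points is an order isomorphism from preorders under inclusion to
  irreducible closed sets. This transfer and the following ones allow chains, their lengths and
  their maximality to be studied on preorders.\<close>

lemma chain_preorders_below_iff:
  assumes "R \<subseteq> monoid_preorders G"
  shows "subset.chain {C. irreducible_closedin (preorder_space G) C} (preorders_below G ` R) \<longleftrightarrow>
     subset.chain (monoid_preorders G) R"
proof -
  have "preorders_below G X \<subseteq> preorders_below G Y \<longleftrightarrow> X \<subseteq> Y" if "X \<in> R" for X Y
    using preorders_below_subset_iff that assms by blast
  then show ?thesis
    using assms unfolding irreducible_closedin_preorder_space subset_chain_def by (simp add: image_mono)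
qed

lemma chain_irreducible_closedin:
  assumes "subset.chain {C. irreducible_closedin (preorder_space G) C} \<C>"
  obtains R where "R \<subseteq> monoid_preorders G" "\<C> = preorders_below G ` R"
  using assms unfolding irreducible_closedin_preorder_space subset_chain_def
  by (meson subset_image_iff)

lemma maxchain_preorders_below_iff:
  assumes R: "R \<subseteq> monoid_preorders G"
  shows "subset.maxchain {C. irreducible_closedin (preorder_space G) C} (preorders_below G ` R) \<longleftrightarrow>
     subset.maxchain (monoid_preorders G) R"
proof -
  let ?I = "{C. irreducible_closedin (preorder_space G) C}" and ?P = "monoid_preorders G"
  have "(\<exists>\<S>. subset.chain ?I \<S> \<and> preorders_below G ` R \<subset> \<S>) \<longleftrightarrow>
      (\<exists>S. subset.chain ?P S \<and> R \<subset> S)"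
  proof
    assume "\<exists>\<S>. subset.chain ?I \<S> \<and> preorders_below G ` R \<subset> \<S>"
    then obtain \<S> where \<S>: "subset.chain ?I \<S>" "preorders_below G ` R \<subset> \<S>" by blast
    obtain S where S: "S \<subseteq> ?P" "\<S> = preorders_below G ` S"
      using chain_irreducible_closedin[OF \<S>(1)] .
    have "R \<subset> S"
    proof
      show "R \<subseteq> S"
      proof
        fix x assume "x \<in> R"
        then show "x \<in> S"
          using \<S>(2) S R inj_on_image_mem_iff[OF inj_on_preorders_below _ S(1), of x] by blast
      qed
      show "R \<noteq> S" using \<S>(2) S(2) by blast
    qed
    moreover have "subset.chain ?P S"
      using \<S>(1) chain_preorders_below_iff[OF S(1)] S(2) by simp
    ultimately show "\<exists>S. subset.chain ?P S \<and> R \<subset> S" by blast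
  next
    assume "\<exists>S. subset.chain ?P S \<and> R \<subset> S"
    then obtain S where S: "subset.chain ?P S" "R \<subset> S" by blast
    then have sub: "S \<subseteq> ?P" by (simp add: subset_chain_def)
    then have "preorders_below G ` R \<subset> preorders_below G ` S"
      using S(2) inj_on_image_eq_iff[OF inj_on_preorders_below R sub] by blast
    moreover have "subset.chain ?I (preorders_below G ` S)"
      using S(1) chain_preorders_below_iff[OF sub] by simp
    ultimately show "\<exists>\<S>. subset.chain ?I \<S> \<and> preorders_below G ` R \<subset> \<S>" by blast
  qed
  then show ?thesis
    unfolding subset.maxchain_def using chain_preorders_below_iff[OF R] by blast
qed

lemma chain_length_preorders_below:
  assumes "R \<subseteq> monoid_preorders G"
  shows "chain_length (preorders_below G ` R) = chain_length R"
  using inj_on_subset[OF inj_on_preorders_below assms]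
  by (simp add: chain_length_def card_image finite_image_iff)

lemma krull_dim_preorder_space:
  "krull_dim (preorder_space G) =
     (SUP R\<in>{R. finite R \<and> R \<noteq> {} \<and> subset.chain (monoid_preorders G) R}. chain_length R)"
proof -
  let ?I = "{C. irreducible_closedin (preorder_space G) C}" and ?P = "monoid_preorders G"
  have "{\<C>. finite \<C> \<and> \<C> \<noteq> {} \<and> subset.chain ?I \<C>} =
      (`) (preorders_below G) ` {R. finite R \<and> R \<noteq> {} \<and> subset.chain ?P R}" (is "?L = ?R")
  proof
    show "?L \<subseteq> ?R"
    proof clarify
      fix \<C> assume \<C>: "finite \<C>" "\<C> \<noteq> {}" "subset.chain ?I \<C>"
      obtain R where R: "R \<subseteq> ?P" "\<C> = preorders_below G ` R"
        using chain_irreducible_closedin[OF \<C>(3)] .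
      have "finite R"
        using \<C>(1) R finite_image_iff[OF inj_on_subset[OF inj_on_preorders_below R(1)]] by simp
      moreover have "subset.chain ?P R"
        using \<C>(3) chain_preorders_below_iff[OF R(1)] R(2) by simp
      moreover have "R \<noteq> {}" using \<C>(2) R(2) by blast
      ultimately show "\<C> \<in> ?R" unfolding R(2) by blast
    qed
    show "?R \<subseteq> ?L"
    proof clarify
      fix R assume R: "finite R" "R \<noteq> {}" "subset.chain ?P R"
      then have "R \<subseteq> ?P" by (simp add: subset_chain_def)
      with R show "finite (preorders_below G ` R) \<and> preorders_below G ` R \<noteq> {} \<and>
          subset.chain ?I (preorders_below G ` R)"
        by (simp add: chain_preorders_below_iff)
    qed
  qed
  then show ?thesis
    unfolding krull_dim_def
    by (simp add: image_image, intro SUP_cong refl chain_length_preorders_below)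
       (simp add: subset_chain_def)
qed

lemma pure_dimensional_preorder_space:
  "pure_dimensional (preorder_space G) \<longleftrightarrow>
     (\<forall>R S. subset.maxchain (monoid_preorders G) R \<and> subset.maxchain (monoid_preorders G) S \<longrightarrow>
        chain_length R = chain_length S)" (is "_ = ?rhs")
proof -
  let ?I = "{C. irreducible_closedin (preorder_space G) C}" and ?P = "monoid_preorders G"
  have sub: "R \<subseteq> ?P" if "subset.maxchain ?P R" for R
    using that by (simp add: subset.maxchain_def subset_chain_def)
  show ?thesis
  proof
    assume pure: "pure_dimensional (preorder_space G)"
    show ?rhs
    proof clarify
      fix R S assume RS: "subset.maxchain ?P R" "subset.maxchain ?P S"
      note sub = sub[OF RS(1)] sub[OF RS(2)]
      have "chain_length (preorders_below G ` R) = chain_length (preorders_below G ` S)"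
        using pure RS sub unfolding pure_dimensional_def by (simp add: maxchain_preorders_below_iff)
      then show "chain_length R = chain_length S"
        using sub by (simp add: chain_length_preorders_below)
    qed
  next
    assume rhs: ?rhs
    show "pure_dimensional (preorder_space G)"
      unfolding pure_dimensional_def
    proof clarify
      fix \<C> \<D> assume mc: "subset.maxchain ?I \<C>" "subset.maxchain ?I \<D>"
      obtain R where R: "R \<subseteq> ?P" "\<C> = preorders_below G ` R"
        using chain_irreducible_closedin[OF subset.maxchain_imp_chain[OF mc(1)]] .
      obtain S where S: "S \<subseteq> ?P" "\<D> = preorders_below G ` S"
        using chain_irreducible_closedin[OF subset.maxchain_imp_chain[OF mc(2)]] .
      have "subset.maxchain ?P R" "subset.maxchain ?P S"
        using mc unfolding R(2) S(2) maxchain_preorders_below_iff[OF R(1)]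
          maxchain_preorders_below_iff[OF S(1)] .
      with rhs have "chain_length R = chain_length S" by blast
      then show "chain_length \<C> = chain_length \<D>"
        unfolding R(2) S(2) chain_length_preorders_below[OF R(1)]
          chain_length_preorders_below[OF S(1)] .
    qed
  qed
qed

section \<open>Preorders on monomials\<close>

text \<open>Only the exponent of the first variable is compared, and all values from
  \<open>k\<close> on are identified. This respects multiplication because
  \<open>min (l + i) k\<close> is a monotone function of \<open>min i k\<close>.\<close>

definition truncated_degree_preorder :: "nat \<Rightarrow> nat \<Rightarrow> (nat \<Rightarrow> nat) rel" where
  "truncated_degree_preorder n k =
     {(a, b). a \<in> carrier (Mon n) \<and> b \<in> carrier (Mon n) \<and> min (a 0) k \<le> min (b 0) k}"

lemma truncated_degree_preorder:
  assumes "n \<ge> 1"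
  shows "truncated_degree_preorder n k \<in> monoid_preorders (Mon n)"
proof -
  interpret comm_monoid "Mon n" by (rule comm_monoid_Mon)
  have mult: "(u \<otimes>\<^bsub>Mon n\<^esub> v) 0 = u 0 + v 0" for u v
    using assms by (simp add: Mon_def nat_add_monoid_def)
  have "min (l + i) k \<le> min (l + j) k" if "min i k \<le> min j k" for i j l :: nat
    using that by linarith
  then show ?thesis
    unfolding monoid_preorders_iff truncated_degree_preorder_def by (auto simp: mult)
qed

lemma truncated_degree_preorder_antimono:
  "j \<le> k \<Longrightarrow> truncated_degree_preorder n k \<subseteq> truncated_degree_preorder n j"
  by (auto simp: truncated_degree_preorder_def min_def split: if_splits)

lemma truncated_degree_preorder_neq:
  assumes "n \<ge> 1" "j < k"
  shows "truncated_degree_preorder n j \<noteq> truncated_degree_preorder n k"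
proof -
  \<comment> \<open>Constant vectors with entries \<open>k\<close> and \<open>j\<close>: truncation
    at \<open>j\<close> identifies their first exponents, truncation at \<open>k\<close> separates
    them.\<close>
  let ?d = "\<lambda>m. restrict (\<lambda>_. m :: nat) {..<n}"
  have "(?d k, ?d j) \<in> truncated_degree_preorder n j" "(?d k, ?d j) \<notin> truncated_degree_preorder n k"
    using assms by (auto simp: truncated_degree_preorder_def Mon_def nat_add_monoid_def)
  then show ?thesis by blast
qed

lemma not_noetherian_spaceI:
  assumes "\<And>i :: nat. closedin X (C i)" "\<And>i. C (Suc i) \<subset> C i"
  shows "\<not> noetherian_space X"
proof
  assume "noetherian_space X"
  moreover have "decseq C" by (rule decseq_SucI) (rule psubset_imp_subset[OF assms(2)])
  ultimately have "\<exists>N. \<forall>i\<ge>N. C i = C N"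
    using assms(1) unfolding noetherian_space_def by (elim allE[of _ C]) simp
  then obtain N where "\<forall>i\<ge>N. C i = C N" ..
  then have "C (Suc N) = C N" by (blast intro: le_SucI)
  with assms(2) show False by blast
qed

lemma not_noetherian_Mon:
  assumes "n \<ge> 1"
  shows "\<not> noetherian_space (preorder_space (Mon n))"
proof (rule not_noetherian_spaceI)
  fix k
  let ?r = "truncated_degree_preorder n"
  show "closedin (preorder_space (Mon n)) (preorders_below (Mon n) (?r k))"
    using closedin_preorders_below truncated_degree_preorder[OF assms] .
  have "?r (Suc k) \<subset> ?r k"
    using truncated_degree_preorder_antimono[of k "Suc k" n]
      truncated_degree_preorder_neq[OF assms, of k "Suc k"] by auto
  then show "preorders_below (Mon n) (?r (Suc k)) \<subset> preorders_below (Mon n) (?r k)"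
    using preorders_below_subset_iff[OF truncated_degree_preorder[OF assms]]
    unfolding psubset_eq inj_on_eq_iff[OF inj_on_preorders_below truncated_degree_preorder[OF assms]
      truncated_degree_preorder[OF assms]] by blast
qed

lemma krull_dim_Mon:
  assumes "n \<ge> 1"
  shows "krull_dim (preorder_space (Mon n)) = \<infinity>"
proof -
  have "enat k \<le> krull_dim (preorder_space (Mon n))" for k
  proof -
    let ?R = "truncated_degree_preorder n ` {..k}"
    have "inj_on (truncated_degree_preorder n) {..k}"
      using truncated_degree_preorder_neq[OF assms] by (intro linorder_inj_onI) auto
    then have "chain_length ?R = enat k" by (simp add: chain_length_def card_image)
    moreover have "subset.chain (monoid_preorders (Mon n)) ?R"
      using truncated_degree_preorder[OF assms] truncated_degree_preorder_antimono
      unfolding subset_chain_def using nat_le_linear by blast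
    ultimately show ?thesis unfolding krull_dim_preorder_space
      by (intro SUP_upper2[of ?R]) auto
  qed
  then show ?thesis
    by (metis enat_ord_code(4) enat.exhaust Suc_ile_eq enat_ord_simps(2) less_irrefl not_infinity_eq)
qed

section \<open>Preorders on the lattice of integer vectors\<close>

text \<open>A preorder on \<open>Zn n\<close> is determined by the vectors \<open>f\<close> with \<open>0 \<le> f\<close>. Vectors are written as
  arbitrary functions, of which only the values at \<open>{..<n}\<close> matter.\<close>

definition nonneg :: "nat \<Rightarrow> (nat \<Rightarrow> int) rel \<Rightarrow> (nat \<Rightarrow> int) \<Rightarrow> bool" where
  "nonneg n r f \<longleftrightarrow> (restrict (\<lambda>_. 0) {..<n}, restrict f {..<n}) \<in> r"

definition indifferent :: "nat \<Rightarrow> (nat \<Rightarrow> int) rel \<Rightarrow> (nat \<Rightarrow> int) \<Rightarrow> bool" where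
  "indifferent n r f \<longleftrightarrow> nonneg n r f \<and> nonneg n r (\<lambda>i. - f i)"

definition cone_preorder :: "nat \<Rightarrow> ((nat \<Rightarrow> int) \<Rightarrow> bool) \<Rightarrow> (nat \<Rightarrow> int) rel" where
  "cone_preorder n P =
     {(x, y). x \<in> carrier (Zn n) \<and> y \<in> carrier (Zn n) \<and> P (\<lambda>i. y i - x i)}"

lemma restrict_in_Zn: "restrict f {..<n} \<in> carrier (Zn n)"
  by (simp add: Zn_def integer_group_def)

lemma restrict_Zn: "x \<in> carrier (Zn n) \<Longrightarrow> restrict x {..<n} = x"
  by (simp add: Zn_def PiE_iff extensional_restrict)

lemma mult_Zn: "x \<otimes>\<^bsub>Zn n\<^esub> y = restrict (\<lambda>i. x i + y i) {..<n}"
  by (simp add: Zn_def integer_group_def)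

text \<open>Translation turns \<open>u <= v\<close> into \<open>0 <= v - u\<close>, so preorders on
  the group come from cones closed under addition that contain \<open>f\<close> or
  \<open>- f\<close>; the case \<open>f = 0\<close> gives reflexivity. By \<open>cong\<close>, cones
  can be written down for arbitrary functions without restricting them.\<close>

lemma cone_preorder:
  assumes cong: "\<And>f g. (\<And>i. i < n \<Longrightarrow> f i = g i) \<Longrightarrow> P f = P g"
    and add: "\<And>f g. P f \<Longrightarrow> P g \<Longrightarrow> P (\<lambda>i. f i + g i)"
    and total: "\<And>f. P f \<or> P (\<lambda>i. - f i)"
  shows "cone_preorder n P \<in> monoid_preorders (Zn n)"
    and "nonneg n (cone_preorder n P) f \<longleftrightarrow> P f"
proof -
  interpret comm_monoid "Zn n" by (rule comm_monoid_Zn)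
  have total': "P (\<lambda>i. v i - u i) \<or> P (\<lambda>i. u i - v i)" for u v
    using total[of "\<lambda>i. v i - u i"] by simp
  have trans': "P (\<lambda>i. w i - u i)" if "P (\<lambda>i. v i - u i)" "P (\<lambda>i. w i - v i)" for u v w
    using add[OF that] by simp
  have mult': "P (\<lambda>i. (u \<otimes>\<^bsub>Zn n\<^esub> w) i - (u \<otimes>\<^bsub>Zn n\<^esub> v) i) \<longleftrightarrow> P (\<lambda>i. w i - v i)" for u v w
    by (rule cong) (simp add: mult_Zn)
  show "cone_preorder n P \<in> monoid_preorders (Zn n)"
    unfolding monoid_preorders_iff cone_preorder_def
    using total' trans' by (auto simp: mult')
  have "P (\<lambda>i. restrict f {..<n} i - restrict (\<lambda>_. 0) {..<n} i) \<longleftrightarrow> P f"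
    by (rule cong) simp
  then show "nonneg n (cone_preorder n P) f \<longleftrightarrow> P f"
    by (simp add: nonneg_def cone_preorder_def restrict_in_Zn)
qed

locale Zn_preorder =
  fixes n :: nat and r :: "(nat \<Rightarrow> int) rel"
  assumes preorder: "r \<in> monoid_preorders (Zn n)"
begin

lemma nonneg_cong: "(\<And>i. i < n \<Longrightarrow> f i = g i) \<Longrightarrow> nonneg n r f = nonneg n r g"
  unfolding nonneg_def by (metis lessThan_iff restrict_ext)

lemma translate:
  assumes "(restrict f {..<n}, restrict g {..<n}) \<in> r"
  shows "(restrict (\<lambda>i. h i + f i) {..<n}, restrict (\<lambda>i. h i + g i) {..<n}) \<in> r"
proof -
  have "(restrict h {..<n} \<otimes>\<^bsub>Zn n\<^esub> restrict f {..<n},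
      restrict h {..<n} \<otimes>\<^bsub>Zn n\<^esub> restrict g {..<n}) \<in> r"
    using preorder assms restrict_in_Zn by (simp add: monoid_preorders_iff)
  moreover have "restrict h {..<n} \<otimes>\<^bsub>Zn n\<^esub> restrict k {..<n} = restrict (\<lambda>i. h i + k i) {..<n}" for k
    unfolding mult_Zn by (rule restrict_ext) simp
  ultimately show ?thesis by simp
qed

lemma mem_iff_nonneg:
  "(x, y) \<in> r \<longleftrightarrow> x \<in> carrier (Zn n) \<and> y \<in> carrier (Zn n) \<and> nonneg n r (\<lambda>i. y i - x i)"
proof -
  have "nonneg n r (\<lambda>i. y i - x i)" if xy: "(x, y) \<in> r"
  proof -
    have "x \<in> carrier (Zn n)" "y \<in> carrier (Zn n)"
      using preorder xy by (auto simp: monoid_preorders_iff)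
    then show ?thesis
      using translate[of x y "\<lambda>i. - x i"] xy by (simp add: restrict_Zn nonneg_def)
  qed
  moreover have "(x, y) \<in> r"
    if "x \<in> carrier (Zn n)" "y \<in> carrier (Zn n)" "nonneg n r (\<lambda>i. y i - x i)"
    using translate[of "\<lambda>_. 0" "\<lambda>i. y i - x i" x] that by (simp add: restrict_Zn nonneg_def)
  ultimately show ?thesis using preorder by (auto simp: monoid_preorders_iff)
qed

lemma nonneg_zero: "nonneg n r (\<lambda>_. 0)"
  using preorder restrict_in_Zn unfolding nonneg_def monoid_preorders_iff by blast

lemma nonneg_add:
  assumes "nonneg n r f" "nonneg n r g"
  shows "nonneg n r (\<lambda>i. f i + g i)"
proof -
  have "(restrict f {..<n}, restrict (\<lambda>i. f i + g i) {..<n}) \<in> r"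
    using translate[of "\<lambda>_. 0" g f] assms(2) by (simp add: nonneg_def)
  with assms(1) preorder show ?thesis unfolding nonneg_def monoid_preorders_iff by blast
qed

lemma nonneg_total: "nonneg n r f \<or> nonneg n r (\<lambda>i. - f i)"
proof -
  have "(restrict (\<lambda>_. 0) {..<n}, restrict f {..<n}) \<in> r \<or>
      (restrict f {..<n}, restrict (\<lambda>_. 0) {..<n}) \<in> r"
    using preorder restrict_in_Zn unfolding monoid_preorders_iff by blast
  then show ?thesis
    using translate[of f "\<lambda>_. 0" "\<lambda>i. - f i"] by (auto simp: nonneg_def)
qed

lemma nonneg_mult:
  assumes "nonneg n r f"
  shows "nonneg n r (\<lambda>i. int k * f i)"
proof (induction k)
  case 0
  show ?case using nonneg_zero by simp
next
  case (Suc k)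
  show ?case using nonneg_add[OF assms Suc] by (simp add: algebra_simps)
qed

lemma nonneg_mult_int: "nonneg n r f \<Longrightarrow> c \<ge> 0 \<Longrightarrow> nonneg n r (\<lambda>i. c * f i)"
  using nonneg_mult[of f "nat c"] by simp

text \<open>If \<open>f\<close> is not above \<open>0\<close>, then \<open>- f\<close> is, and
  adding \<open>c - 1\<close> copies of \<open>- f\<close> to \<open>c f\<close> yields
  \<open>f\<close>. This makes the quotient by the vectors indifferent to \<open>0\<close>
  torsion-free.\<close>

lemma nonneg_div:
  assumes "nonneg n r (\<lambda>i. c * f i)" "c > 0"
  shows "nonneg n r f"
proof (rule ccontr)
  assume nf: "\<not> nonneg n r f"
  then have "nonneg n r (\<lambda>i. - f i)" using nonneg_total by blast
  then have "nonneg n r (\<lambda>i. (c - 1) * - f i)" using assms(2) by (intro nonneg_mult_int) auto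
  from nonneg_add[OF assms(1) this] have "nonneg n r f" by (simp add: algebra_simps)
  with nf show False ..
qed

lemma indifferent_uminus: "indifferent n r f \<Longrightarrow> indifferent n r (\<lambda>i. - f i)"
  by (simp add: indifferent_def)

lemma indifferent_add:
  assumes "indifferent n r f" "indifferent n r g"
  shows "indifferent n r (\<lambda>i. f i + g i)"
  using assms nonneg_add[of f g] nonneg_add[of "\<lambda>i. - f i" "\<lambda>i. - g i"]
  by (simp add: indifferent_def algebra_simps)

lemma indifferent_mult:
  assumes "indifferent n r f"
  shows "indifferent n r (\<lambda>i. c * f i)"
proof -
  have *: "indifferent n r (\<lambda>i. c * f i)" if "indifferent n r f" "c \<ge> 0" for c f
    using that nonneg_mult_int[of f c] nonneg_mult_int[of "\<lambda>i. - f i" c]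
    by (simp add: indifferent_def)
  show ?thesis
  proof (cases "c \<ge> 0")
    case False
    with *[OF indifferent_uminus[OF assms], of "- c"] show ?thesis by simp
  qed (use * assms in blast)
qed

lemma indifferent_div:
  assumes "indifferent n r (\<lambda>i. c * f i)" "c \<noteq> 0"
  shows "indifferent n r f"
proof -
  have *: "indifferent n r f" if "indifferent n r (\<lambda>i. c * f i)" "c > 0" for c f
    using that nonneg_div[of c f] nonneg_div[of c "\<lambda>i. - f i"]
    by (simp add: indifferent_def)
  show ?thesis
  proof (cases "c > 0")
    case True
    with * assms show ?thesis by blast
  next
    case False
    with assms have "- c > 0" by simp
    with *[of "- c" f] indifferent_uminus[OF assms(1)] show ?thesis by simp
  qed
qed

lemma indifferent_cong: "(\<And>i. i < n \<Longrightarrow> f i = g i) \<Longrightarrow> indifferent n r f = indifferent n r g"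
  unfolding indifferent_def using nonneg_cong[of f g] nonneg_cong[of "\<lambda>i. - f i" "\<lambda>i. - g i"]
  by simp

end

lemma Zn_preorder_subset_iff:
  assumes "r \<in> monoid_preorders (Zn n)" "s \<in> monoid_preorders (Zn n)"
  shows "s \<subseteq> r \<longleftrightarrow> (\<forall>f. nonneg n s f \<longrightarrow> nonneg n r f)"
proof -
  interpret r: Zn_preorder n r by unfold_locales fact
  interpret s: Zn_preorder n s by unfold_locales fact
  show ?thesis
  proof
    assume "s \<subseteq> r"
    then show "\<forall>f. nonneg n s f \<longrightarrow> nonneg n r f" unfolding nonneg_def by blast
  next
    assume "\<forall>f. nonneg n s f \<longrightarrow> nonneg n r f"
    then show "s \<subseteq> r" using r.mem_iff_nonneg s.mem_iff_nonneg by auto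
  qed
qed

text \<open>If \<open>f\<close> is nonnegative for \<open>r\<close> but not for \<open>s\<close>,
  then \<open>- f\<close> is nonnegative for \<open>s\<close>, hence for \<open>r\<close>; so
  \<open>f\<close> is indifferent for \<open>r\<close> and \<open>ker\<close> applies.\<close>

lemma Zn_preorder_eqI:
  assumes "r \<in> monoid_preorders (Zn n)" "s \<in> monoid_preorders (Zn n)" "s \<subseteq> r"
    and ker: "\<And>f. indifferent n r f \<Longrightarrow> indifferent n s f"
  shows "s = r"
proof -
  interpret r: Zn_preorder n r by unfold_locales fact
  interpret s: Zn_preorder n s by unfold_locales fact
  have "nonneg n s f" if f: "nonneg n r f" for f
  proof (rule ccontr)
    assume nf: "\<not> nonneg n s f"
    then have "nonneg n s (\<lambda>i. - f i)" using s.nonneg_total by blast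
    then have "nonneg n r (\<lambda>i. - f i)" using assms(3) by (auto simp: nonneg_def)
    with f have "indifferent n s f" by (intro ker) (simp add: indifferent_def)
    with nf show False by (simp add: indifferent_def)
  qed
  then have "r \<subseteq> s" using Zn_preorder_subset_iff[OF assms(2,1)] by blast
  with assms(3) show ?thesis by blast
qed

text \<open>The positions of the pivots of a row echelon form of the subgroup of vectors indifferent to
  \<open>0\<close>. Their number is the rank of this subgroup.\<close>

definition pivots :: "nat \<Rightarrow> (nat \<Rightarrow> int) rel \<Rightarrow> nat set" where
  "pivots n r = {i. i < n \<and> (\<exists>f. indifferent n r f \<and> f i \<noteq> 0 \<and> (\<forall>j<n. i < j \<longrightarrow> f j = 0))}"

lemma pivots_subset: "pivots n r \<subseteq> {..<n}"
  by (auto simp: pivots_def)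

lemma finite_pivots: "finite (pivots n r)"
  by (rule finite_subset[OF pivots_subset]) simp

lemma pivots_mono:
  assumes "s \<subseteq> r"
  shows "pivots n s \<subseteq> pivots n r"
  using assms unfolding pivots_def indifferent_def nonneg_def by blast

text \<open>Gaussian elimination from the last coordinate downwards. If \<open>f\<close> ends at
  position \<open>m\<close>, a vector \<open>g\<close> indifferent for \<open>s\<close> ends there
  too, and the integer combination \<open>g m * f - f m * g\<close> ends earlier. Induction makes
  \<open>g m * f\<close> indifferent for \<open>s\<close>, and torsion-freeness removes the factor
  \<open>g m\<close>.\<close>

lemma pivots_strict:
  assumes "r \<in> monoid_preorders (Zn n)" "s \<in> monoid_preorders (Zn n)" "s \<subseteq> r"
    and piv: "pivots n r \<subseteq> pivots n s"
  shows "s = r"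
proof (rule Zn_preorder_eqI[OF assms(1-3)])
  interpret r: Zn_preorder n r by unfold_locales fact
  interpret s: Zn_preorder n s by unfold_locales fact
  have sub: "indifferent n s f \<Longrightarrow> indifferent n r f" for f
    using assms(3) unfolding indifferent_def nonneg_def by blast
  have "indifferent n s f"
    if "m \<le> n" "indifferent n r f" "\<forall>j<n. m \<le> j \<longrightarrow> f j = 0" for m f
    using that
  proof (induction m arbitrary: f)
    case 0
    then have "indifferent n s f = indifferent n s (\<lambda>_. 0)" by (intro s.indifferent_cong) simp
    then show ?case using s.nonneg_zero by (simp add: indifferent_def)
  next
    case (Suc m)
    show ?case
    proof (cases "f m = 0")
      case True
      then have "\<forall>j<n. m \<le> j \<longrightarrow> f j = 0" using Suc.prems(3) le_neq_implies_less by (metis Suc_leI)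
      then show ?thesis using Suc by simp
    next
      case False
      then have "m \<in> pivots n r" using Suc.prems by (auto simp: pivots_def intro!: exI[of _ f])
      then obtain g where g: "indifferent n s g" "g m \<noteq> 0" "\<forall>j<n. m < j \<longrightarrow> g j = 0"
        using piv by (auto simp: pivots_def)
      let ?h = "\<lambda>i. g m * f i + (- f m) * g i"
      have "indifferent n r ?h"
        using Suc.prems(2) sub[OF g(1)] by (intro r.indifferent_add r.indifferent_mult)
      moreover have "\<forall>j<n. m \<le> j \<longrightarrow> ?h j = 0"
        using Suc.prems(3) g(3) by (metis (no_types, lifting) Suc_leI le_neq_implies_less
            mult.commute mult_minus_left add.right_inverse mult_zero_right add_0)
      ultimately have "indifferent n s ?h" using Suc.IH[of ?h] Suc.prems(1) by simp
      from s.indifferent_add[OF this s.indifferent_mult[OF g(1), of "f m"]]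
      have "indifferent n s (\<lambda>i. g m * f i)" by simp
      then show ?thesis using g(2) by (rule s.indifferent_div)
    qed
  qed
  from this[of n] show "indifferent n s f" if "indifferent n r f" for f using that by simp
qed

text \<open>Pivot sets along a chain are nested, so equal cardinality means equal pivot sets and
  then equal preorders.\<close>

lemma inj_on_card_pivots:
  assumes "subset.chain (monoid_preorders (Zn n)) R"
  shows "inj_on (\<lambda>r. card (pivots n r)) R"
proof (rule inj_onI)
  fix r s assume rs: "r \<in> R" "s \<in> R" "card (pivots n r) = card (pivots n s)"
  have *: "s = r" if "s \<subseteq> r" "r \<in> R" "s \<in> R" "card (pivots n r) = card (pivots n s)" for r s
  proof -
    have "pivots n s = pivots n r"
      using card_subset_eq[OF finite_pivots pivots_mono[OF that(1)]] that(4) by simp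
    then show ?thesis
      using pivots_strict[of r n s] that assms unfolding subset_chain_def by blast
  qed
  have "r \<subseteq> s \<or> s \<subseteq> r" using rs assms unfolding subset_chain_def by blast
  then show "r = s" using * rs by metis
qed

lemma card_pivots_le: "card (pivots n r) \<le> n"
  using card_mono[OF _ pivots_subset, of n r] by simp

lemma chain_Zn_bound:
  assumes "subset.chain (monoid_preorders (Zn n)) R"
  shows "finite R" "card R \<le> Suc n"
proof -
  have sub: "(\<lambda>r. card (pivots n r)) ` R \<subseteq> {..n}" using card_pivots_le by blast
  show "finite R" using inj_on_card_pivots[OF assms] sub by (rule inj_on_finite) simp
  show "card R \<le> Suc n"
    using card_inj_on_le[OF inj_on_card_pivots[OF assms] sub] by simp
qed

section \<open>Lexicographic preorders and the Krull dimension of the lattice case\<close>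

definition lex_preorder :: "nat \<Rightarrow> nat \<Rightarrow> (nat \<Rightarrow> int) rel" where
  "lex_preorder n k = cone_preorder n (\<lambda>f. \<forall>i<k. (\<forall>j<i. f j = 0) \<longrightarrow> f i \<ge> 0)"

text \<open>The condition says that the first nonzero entry among the first \<open>k\<close>
  coordinates, if there is one, is positive. The remaining coordinates are ignored, so
  \<open>k = 0\<close> is the trivial preorder and the rank of the indifferent vectors is
  \<open>n - k\<close>.\<close>

lemma lex_preorder:
  assumes "k \<le> n"
  shows "lex_preorder n k \<in> monoid_preorders (Zn n)"
    and "nonneg n (lex_preorder n k) f \<longleftrightarrow> (\<forall>i<k. (\<forall>j<i. f j = 0) \<longrightarrow> f i \<ge> 0)"
proof -
  let ?P = "\<lambda>f :: nat \<Rightarrow> int. \<forall>i<k. (\<forall>j<i. f j = 0) \<longrightarrow> f i \<ge> 0"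
  have cong: "?P f = ?P g" if fg: "\<And>i. i < n \<Longrightarrow> f i = g i" for f g
  proof -
    have "f i = g i" if "i < k" for i using fg assms that by simp
    then show ?thesis by (metis order.strict_trans)
  qed
  have add: "?P (\<lambda>i. f i + g i)" if P: "?P f" "?P g" for f g
  proof clarify
    fix i assume i: "i < k" "\<forall>j<i. f j + g j = 0"
    \<comment> \<open>No cancellation can occur before position \<open>i\<close>: as long as both
      vectors vanish, their next entries are nonnegative with sum zero.\<close>
    have zero: "f j = 0 \<and> g j = 0" if "j < i" for j
      using that
    proof (induction j rule: less_induct)
      case (less j)
      then have "f j \<ge> 0" "g j \<ge> 0" using P i(1) by (meson order.strict_trans)+
      moreover have "f j + g j = 0" using i(2) less.prems by blast
      ultimately show ?case by linarith
    qed
    then have "f i \<ge> 0" "g i \<ge> 0" using P i(1) by blast+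
    then show "f i + g i \<ge> 0" by simp
  qed
  have total: "?P f \<or> ?P (\<lambda>i. - f i)" for f
  proof (rule disjCI)
    assume "\<not> ?P (\<lambda>i. - f i)"
    then obtain m where m: "m < k" "\<forall>j<m. f j = 0" "f m > 0" by auto
    show "?P f"
    proof clarify
      fix i assume "i < k" "\<forall>j<i. f j = 0"
      with m show "f i \<ge> 0" by (metis less_irrefl linorder_less_linear order.order_iff_strict)
    qed
  qed
  show "lex_preorder n k \<in> monoid_preorders (Zn n)"
    unfolding lex_preorder_def by (rule cone_preorder(1)[OF cong add total])
  show "nonneg n (lex_preorder n k) f \<longleftrightarrow> ?P f"
    unfolding lex_preorder_def by (rule cone_preorder(2)[OF cong add total])
qed

lemma lex_preorder_antimono:
  assumes "j \<le> k"
  shows "lex_preorder n k \<subseteq> lex_preorder n j"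
  using assms by (auto simp: lex_preorder_def cone_preorder_def)

lemma lex_preorder_neq:
  assumes "j < k" "k \<le> n"
  shows "lex_preorder n j \<noteq> lex_preorder n k"
proof -
  \<comment> \<open>The negative of the unit vector at \<open>j\<close> is invisible to the first
    \<open>j\<close> coordinates and negative as soon as coordinate \<open>j\<close> is
    read.\<close>
  let ?f = "\<lambda>i. if i = j then - 1 else 0 :: int"
  have "nonneg n (lex_preorder n j) ?f" using assms by (subst lex_preorder(2)) auto
  moreover have "\<not> nonneg n (lex_preorder n k) ?f"
    using assms by (subst lex_preorder(2)) (auto intro!: exI[of _ j])
  ultimately show ?thesis by metis
qed

lemma lex_chain:
  "subset.chain (monoid_preorders (Zn n)) (lex_preorder n ` {..n})" "card (lex_preorder n ` {..n}) = Suc n"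
proof -
  have "lex_preorder n ` {..n} \<subseteq> monoid_preorders (Zn n)" using lex_preorder(1) by blast
  moreover have "lex_preorder n i \<subseteq> lex_preorder n j \<or> lex_preorder n j \<subseteq> lex_preorder n i" for i j
    using lex_preorder_antimono nat_le_linear by blast
  ultimately show "subset.chain (monoid_preorders (Zn n)) (lex_preorder n ` {..n})"
    unfolding subset_chain_def by blast
  have "inj_on (lex_preorder n) {..n}"
    using lex_preorder_neq by (intro linorder_inj_onI) auto
  then show "card (lex_preorder n ` {..n}) = Suc n" by (simp add: card_image)
qed

lemma krull_dim_Zn: "krull_dim (preorder_space (Zn n)) = enat n"
  unfolding krull_dim_preorder_space
proof (rule antisym)
  show "(SUP R\<in>{R. finite R \<and> R \<noteq> {} \<and> subset.chain (monoid_preorders (Zn n)) R}. chain_length R)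
      \<le> enat n"
  proof (rule SUP_least, clarify)
    fix R assume "finite R" "subset.chain (monoid_preorders (Zn n)) R"
    then show "chain_length R \<le> enat n"
      using chain_Zn_bound(2)[of n R] by (simp add: chain_length_def)
  qed
  show "enat n \<le>
      (SUP R\<in>{R. finite R \<and> R \<noteq> {} \<and> subset.chain (monoid_preorders (Zn n)) R}. chain_length R)"
    using lex_chain[of n] by (intro SUP_upper2[of "lex_preorder n ` {..n}"])
      (auto simp: chain_length_def)
qed

section \<open>Preorders given by real weights, and the Noetherian property\<close>

definition weight :: "nat \<Rightarrow> (nat \<Rightarrow> real) \<Rightarrow> (nat \<Rightarrow> int) \<Rightarrow> real" where
  "weight n w f = (\<Sum>i<n. w i * f i)"

definition weight_preorder :: "nat \<Rightarrow> (nat \<Rightarrow> real) \<Rightarrow> (nat \<Rightarrow> int) rel" where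
  "weight_preorder n w = cone_preorder n (\<lambda>f. weight n w f \<ge> 0)"

lemma weight_add: "weight n w (\<lambda>i. f i + g i) = weight n w f + weight n w g"
  by (simp add: weight_def sum.distrib algebra_simps)

lemma weight_uminus: "weight n w (\<lambda>i. - f i) = - weight n w f"
  by (simp add: weight_def sum_negf)

lemma weight_mult: "weight n w (\<lambda>i. c * f i) = c * weight n w f"
  by (simp add: weight_def sum_distrib_left algebra_simps)

lemma weight_preorder:
  "weight_preorder n w \<in> monoid_preorders (Zn n)"
  "nonneg n (weight_preorder n w) f \<longleftrightarrow> weight n w f \<ge> 0"
proof -
  have cong: "weight n w f \<ge> 0 \<longleftrightarrow> weight n w g \<ge> 0" if "\<And>i. i < n \<Longrightarrow> f i = g i" for f g
    using that by (simp add: weight_def)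
  have add: "weight n w (\<lambda>i. f i + g i) \<ge> 0" if "weight n w f \<ge> 0" "weight n w g \<ge> 0" for f g
    using that by (simp add: weight_add)
  have total: "weight n w f \<ge> 0 \<or> weight n w (\<lambda>i. - f i) \<ge> 0" for f
    by (simp add: weight_uminus linorder_linear)
  show "weight_preorder n w \<in> monoid_preorders (Zn n)"
    unfolding weight_preorder_def by (rule cone_preorder(1)[OF cong add total])
  show "nonneg n (weight_preorder n w) f \<longleftrightarrow> weight n w f \<ge> 0"
    unfolding weight_preorder_def by (rule cone_preorder(2)[OF cong add total])
qed

text \<open>The argument is archimedean: once some \<open>f\<close> of nonzero weight is indifferent to \<open>0\<close>, every \<open>g\<close>
  lies above an integer multiple of \<open>f\<close>.\<close>

lemma weight_preorder_coarsening:
  assumes r: "r \<in> monoid_preorders (Zn n)" and sub: "weight_preorder n w \<subseteq> r"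
  shows "r = weight_preorder n w \<or> r = carrier (Zn n) \<times> carrier (Zn n)"
proof (rule disjCI)
  assume "r \<noteq> carrier (Zn n) \<times> carrier (Zn n)"
  interpret r: Zn_preorder n r by unfold_locales fact
  have pos: "nonneg n r f" if "weight n w f \<ge> 0" for f
    using that Zn_preorder_subset_iff[OF r weight_preorder(1)] sub weight_preorder(2) by blast
  have zero: "weight n w f = 0" if f: "indifferent n r f" for f
  proof (rule ccontr)
    assume nz: "weight n w f \<noteq> 0"
    have "nonneg n r g" for g
    proof -
      obtain c :: int where c: "c * weight n w f \<le> weight n w g"
      proof -
        \<comment> \<open>The case split keeps the divisor positive, so that rounding down gives a
          lower bound for \<open>weight n w g\<close>.\<close>
        define c where "c = (if weight n w f > 0 then \<lfloor>weight n w g / weight n w f\<rfloor>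
            else - \<lfloor>weight n w g / (- weight n w f)\<rfloor>)"
        have "c * weight n w f \<le> weight n w g"
          using floor_divide_lower[of "weight n w f" "weight n w g"]
            floor_divide_lower[of "- weight n w f" "weight n w g"] nz
          by (cases "weight n w f > 0") (simp_all add: c_def)
        then show ?thesis by (rule that)
      qed
      have "weight n w (\<lambda>i. g i + (- c) * f i) \<ge> 0"
        using c weight_add[of n w g "\<lambda>i. (- c) * f i"] weight_mult[of n w "- c" f] by simp
      then have "nonneg n r (\<lambda>i. g i + (- c) * f i)" by (rule pos)
      moreover have "nonneg n r (\<lambda>i. c * f i)"
        using r.indifferent_mult[OF f] by (simp add: indifferent_def)
      ultimately show ?thesis using r.nonneg_add by fastforce
    qed
    then have "r = carrier (Zn n) \<times> carrier (Zn n)" using r.mem_iff_nonneg by auto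
    with \<open>r \<noteq> _\<close> show False ..
  qed
  show "r = weight_preorder n w"
  proof (rule Zn_preorder_eqI[symmetric, OF r weight_preorder(1) sub])
    fix f assume "indifferent n r f"
    then show "indifferent n (weight_preorder n w) f"
      using zero by (simp add: indifferent_def weight_preorder(2) weight_uminus)
  qed
qed

text \<open>By totality \<open>0 <= 1\<close> or \<open>0 <= - 1\<close>, so \<open>r\<close>
  coarsens one of the two weight preorders, and these have only the trivial proper
  coarsening.\<close>

lemma monoid_preorders_Z1:
  "monoid_preorders (Zn 1) \<subseteq>
     {weight_preorder 1 (\<lambda>_. 1), weight_preorder 1 (\<lambda>_. - 1), carrier (Zn 1) \<times> carrier (Zn 1)}"
proof
  fix r assume r: "r \<in> monoid_preorders (Zn 1)"
  interpret r: Zn_preorder 1 r by unfold_locales fact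
  have sub: "weight_preorder 1 (\<lambda>_. real_of_int c) \<subseteq> r"
    if c: "c = 1 \<or> c = - 1" "nonneg 1 r (\<lambda>_. c)" for c :: int
  proof -
    have "nonneg 1 r f" if "nonneg 1 (weight_preorder 1 (\<lambda>_. real_of_int c)) f" for f
    proof -
      have "real_of_int (c * f 0) \<ge> 0" using that by (simp add: weight_preorder(2) weight_def)
      then have "c * f 0 \<ge> 0" by linarith
      then have "nonneg 1 r (\<lambda>i. (c * f 0) * c)" by (rule r.nonneg_mult_int[OF c(2)])
      \<comment> \<open>Since \<open>c\<close> squares to \<open>1\<close>, both vectors have the
        same single entry.\<close>
      moreover have "nonneg 1 r (\<lambda>i. (c * f 0) * c) = nonneg 1 r f"
        using c(1) by (intro r.nonneg_cong) auto
      ultimately show ?thesis by simp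
    qed
    then show ?thesis using Zn_preorder_subset_iff[OF r weight_preorder(1)] by blast
  qed
  have "nonneg 1 r (\<lambda>_. 1) \<or> nonneg 1 r (\<lambda>_. - 1)" by (rule r.nonneg_total)
  then show "r \<in> {weight_preorder 1 (\<lambda>_. 1), weight_preorder 1 (\<lambda>_. - 1),
      carrier (Zn 1) \<times> carrier (Zn 1)}"
    using sub[of 1] sub[of "- 1"] weight_preorder_coarsening[OF r] by auto
qed

lemma noetherian_space_finite:
  assumes "finite (topspace X)"
  shows "noetherian_space X"
  unfolding noetherian_space_def
proof (intro allI impI, elim conjE)
  fix C :: "nat \<Rightarrow> 'a set" assume C: "\<forall>i. closedin X (C i)" "decseq C"
  have fin: "finite (C i)" for i
    using C(1) by (blast intro: finite_subset[OF closedin_subset assms])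
  have "\<exists>N. \<forall>i. card (C N) \<le> card (C i)"
    using ex_has_least_nat[of "\<lambda>_. True" 0 "\<lambda>i. card (C i)"] by simp
  then obtain N where N: "\<forall>i. card (C N) \<le> card (C i)" ..
  have "C i = C N" if "N \<le> i" for i
  proof (rule card_subset_eq)
    show "finite (C N)" by (rule fin)
    show sub: "C i \<subseteq> C N" using C(2) that by (rule decseqD)
    show "card (C i) = card (C N)"
      using N card_mono[OF fin sub] by (simp add: le_antisym)
  qed
  then show "\<exists>N. \<forall>i\<ge>N. C i = C N" by blast
qed

lemma noetherian_Z1: "noetherian_space (preorder_space (Zn 1))"
  using finite_subset[OF monoid_preorders_Z1] by (intro noetherian_space_finite) simp

lemma weight_two:
  assumes "n \<ge> 2" "\<And>i. i \<ge> 2 \<Longrightarrow> w i = 0"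
  shows "weight n w f = w 0 * f 0 + w 1 * f 1"
proof -
  have "weight n w f = (\<Sum>i\<in>{0, 1}. w i * f i)"
    unfolding weight_def using assms by (intro sum.mono_neutral_right) auto
  then show ?thesis by simp
qed

text \<open>The closed sets \<open>{0 < e\<^sub>1} \<inter> {k e\<^sub>1 < e\<^sub>0}\<close> are strictly decreasing in \<open>k\<close>.\<close>

lemma not_noetherian_Zn:
  assumes n: "n \<ge> 2"
  shows "\<not> noetherian_space (preorder_space (Zn n))"
proof (rule not_noetherian_spaceI)
  define e :: "int \<Rightarrow> int \<Rightarrow> nat \<Rightarrow> int" where "e a b i = (if i = 0 then a else if i = 1 then b else 0)" for a b i
  \<comment> \<open>By totality, failure of \<open>0 <= - e_1\<close> is \<open>0 < e_1\<close>, and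
    failure of \<open>0 <= - e_0 + k e_1\<close> is \<open>k e_1 < e_0\<close>.\<close>
  define C where "C k = {r \<in> monoid_preorders (Zn n).
      \<not> nonneg n r (e 0 (- 1)) \<and> \<not> nonneg n r (e (- 1) (int k))}" for k
  fix k
  have "{r \<in> monoid_preorders (Zn n). \<not> nonneg n r f} =
      topspace (preorder_space (Zn n)) - basic_open (Zn n) {(restrict (\<lambda>_. 0) {..<n}, restrict f {..<n})}" for f
    by (auto simp: basic_open_def nonneg_def)
  then have "closedin (preorder_space (Zn n)) {r \<in> monoid_preorders (Zn n). \<not> nonneg n r f}" for f
    by (simp only: closedin_diff[OF closedin_topspace] openin_basic_open finite.intros)
  then have "closedin (preorder_space (Zn n))
      ({r \<in> monoid_preorders (Zn n). \<not> nonneg n r (e 0 (- 1))} \<inter>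
       {r \<in> monoid_preorders (Zn n). \<not> nonneg n r (e (- 1) (int k))})"
    by (intro closedin_Int)
  also have "\<dots> = C k" by (auto simp: C_def)
  finally show "closedin (preorder_space (Zn n)) (C k)" .
  show "C (Suc k) \<subset> C k"
  proof
    show "C (Suc k) \<subseteq> C k"
    proof
      fix r assume "r \<in> C (Suc k)"
      then have r: "r \<in> monoid_preorders (Zn n)" "\<not> nonneg n r (e 0 (- 1))"
          "\<not> nonneg n r (e (- 1) (int (Suc k)))"
        by (auto simp: C_def)
      interpret Zn_preorder n r by unfold_locales fact
      have "(\<lambda>i. - e 0 (- 1) i) = e 0 1" by (auto simp: e_def)
      then have "nonneg n r (e 0 1)" using nonneg_total[of "e 0 (- 1)"] r(2) by simp
      moreover have "(\<lambda>i. e (- 1) (int k) i + e 0 1 i) = e (- 1) (int (Suc k))"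
        by (auto simp: e_def)
      ultimately have "\<not> nonneg n r (e (- 1) (int k))"
        using nonneg_add[of "e (- 1) (int k)" "e 0 1"] r(3) by auto
      with r show "r \<in> C k" by (auto simp: C_def)
    qed
    \<comment> \<open>With weights \<open>k + 1\<close> and \<open>1\<close>, \<open>e_0\<close> is
      indifferent to \<open>(k + 1) e_1\<close>: it lies strictly above \<open>k e_1\<close> but
      fails the next strict inequality.\<close>
    define w :: "nat \<Rightarrow> real" where "w i = (if i = 0 then real (Suc k) else if i = 1 then 1 else 0)" for i
    have "weight n w (e a b) = real (Suc k) * a + b" for a b
      using weight_two[OF n, of w] by (simp add: w_def e_def)
    then have "weight_preorder n w \<in> C k" "weight_preorder n w \<notin> C (Suc k)"
      by (auto simp: C_def weight_preorder)
    then show "C (Suc k) \<noteq> C k" by blast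
  qed
qed

section \<open>Maximal chains and pure dimension\<close>

lemma ex_maxchain_Zn:
  assumes "r \<in> monoid_preorders (Zn n)"
  obtains R where "subset.maxchain (monoid_preorders (Zn n)) R" "r \<in> R"
proof -
  let ?Q = "\<lambda>R. subset.chain (monoid_preorders (Zn n)) R \<and> r \<in> R"
  have "?Q {r}" using assms by (simp add: subset_chain_def)
  moreover have "\<forall>R. ?Q R \<longrightarrow> card R < Suc (Suc n)"
    using chain_Zn_bound(2) by (simp add: less_Suc_eq_le)
  \<comment> \<open>The uniform bound on cardinalities takes the place of Zorn's lemma: a chain
    through \<open>r\<close> with the most members is maximal.\<close>
  ultimately have "\<exists>R. ?Q R \<and> (\<forall>S. ?Q S \<longrightarrow> card S \<le> card R)" by (rule ex_has_greatest_nat)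
  then obtain R where R: "?Q R" "\<forall>S. ?Q S \<longrightarrow> card S \<le> card R" by blast
  have "\<not> (\<exists>S. subset.chain (monoid_preorders (Zn n)) S \<and> R \<subset> S)"
  proof (intro notI, elim exE conjE)
    fix S assume S: "subset.chain (monoid_preorders (Zn n)) S" "R \<subset> S"
    have "card R < card S" by (rule psubset_card_mono[OF chain_Zn_bound(1)[OF S(1)] S(2)])
    moreover have "card S \<le> card R" using S R by blast
    ultimately show False by simp
  qed
  with R(1) have "subset.maxchain (monoid_preorders (Zn n)) R" by (simp add: subset.maxchain_def)
  then show ?thesis using R(1) by (intro that) auto
qed

text \<open>The weight \<open>f 0 + \<theta> f 1\<close> with \<open>\<theta>\<close> irrational yields a preorder of rank \<open>n - 2\<close> whose only
  proper coarsening has rank \<open>n\<close>, so chains through it skip the rank \<open>n - 1\<close>.\<close>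

lemma not_pure_dimensional_Zn:
  assumes n: "n \<ge> 2"
  shows "\<not> pure_dimensional (preorder_space (Zn n))"
proof
  assume pure: "pure_dimensional (preorder_space (Zn n))"
  let ?P = "monoid_preorders (Zn n)"
  let ?L = "lex_preorder n ` {..n}"
  have "\<not> (\<exists>S. subset.chain ?P S \<and> ?L \<subset> S)"
  proof (intro notI, elim exE conjE)
    fix S assume S: "subset.chain ?P S" "?L \<subset> S"
    have "card ?L < card S" by (rule psubset_card_mono[OF chain_Zn_bound(1)[OF S(1)] S(2)])
    then show False using chain_Zn_bound(2)[OF S(1)] lex_chain(2)[of n] by simp
  qed
  then have max_lex: "subset.maxchain ?P ?L" using lex_chain(1) by (simp add: subset.maxchain_def)
  have "(\<rat> :: real set) \<noteq> UNIV" using uncountable_UNIV_real countable_rat by metis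
  then obtain \<theta> :: real where \<theta>: "\<theta> \<notin> \<rat>" by blast
  define w :: "nat \<Rightarrow> real" where "w i = (if i = 0 then 1 else if i = 1 then \<theta> else 0)" for i
  let ?s = "weight_preorder n w"
  obtain R where R: "subset.maxchain ?P R" "?s \<in> R" by (rule ex_maxchain_Zn[OF weight_preorder(1)])
  then have chain: "subset.chain ?P R" by (simp add: subset.maxchain_def)
  have "chain_length R = chain_length ?L"
    using pure R(1) max_lex unfolding pure_dimensional_preorder_space by blast
  \<comment> \<open>\<open>chain_length\<close> uses truncated subtraction, so equal lengths give
    equal cardinalities only for nonempty chains.\<close>
  moreover have "card R > 0" using R(2) chain_Zn_bound(1)[OF chain] card_gt_0_iff by blast
  ultimately have card_R: "card R = Suc n"
    using chain_Zn_bound(1)[OF chain] lex_chain(2)[of n] by (simp add: chain_length_def)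
  \<comment> \<open>The \<open>n + 1\<close> members of \<open>R\<close> have distinct ranks between
    \<open>0\<close> and \<open>n\<close>, so every rank occurs, in particular the rank
    \<open>n - 1\<close> that the weight preorder prevents.\<close>
  have "(\<lambda>r. card (pivots n r)) ` R = {..n}"
  proof (rule card_subset_eq)
    show "(\<lambda>r. card (pivots n r)) ` R \<subseteq> {..n}" using card_pivots_le by blast
    show "card ((\<lambda>r. card (pivots n r)) ` R) = card {..n}"
      using card_R card_image[OF inj_on_card_pivots[OF chain]] by simp
  qed simp
  then have "n - 1 \<in> (\<lambda>r. card (pivots n r)) ` R" by simp
  then obtain r where r: "r \<in> R" "card (pivots n r) = n - 1" by auto
  \<comment> \<open>Irrationality of \<open>\<theta>\<close> forces the first two entries of every
    indifferent vector to vanish, which excludes pivots at positions \<open>0\<close> and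
    \<open>1\<close>.\<close>
  have "pivots n ?s \<subseteq> {2..<n}"
  proof
    fix i assume "i \<in> pivots n ?s"
    then obtain f where i: "i < n" and f: "indifferent n ?s f" "f i \<noteq> 0" "\<forall>j<n. i < j \<longrightarrow> f j = 0"
      by (auto simp: pivots_def)
    have "weight n w f = 0" using f(1) by (simp add: indifferent_def weight_preorder(2) weight_uminus)
    then have eq: "f 0 + \<theta> * f 1 = 0" using weight_two[OF n, of w f] by (simp add: w_def)
    have "f 1 = 0"
    proof (rule ccontr)
      assume "f 1 \<noteq> 0"
      with eq have "\<theta> = - (real_of_int (f 0) / real_of_int (f 1))"
        by (simp add: field_simps)
      then have "\<theta> \<in> \<rat>" by (metis Rats_divide Rats_minus_iff Rats_of_int)
      with \<theta> show False ..
    qed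
    with eq have "f 0 = 0" by simp
    with \<open>f 1 = 0\<close> f(2) have "i \<noteq> 0" "i \<noteq> 1" by (metis, metis)
    with i show "i \<in> {2..<n}" by simp
  qed
  then have card_s: "card (pivots n ?s) \<le> n - 2" using card_mono[of "{2..<n}"] by simp
  have rP: "r \<in> ?P" using r(1) chain by (auto simp: subset_chain_def)
  have "r \<subseteq> ?s \<or> ?s \<subseteq> r" using r(1) R(2) chain by (auto simp: subset_chain_def)
  then show False
  proof
    assume "r \<subseteq> ?s"
    then have "pivots n r \<subseteq> pivots n ?s" by (rule pivots_mono)
    then have "card (pivots n r) \<le> card (pivots n ?s)" by (rule card_mono[OF finite_pivots])
    with card_s r(2) n show False by simp
  next
    assume "?s \<subseteq> r"
    then consider "r = ?s" | "r = carrier (Zn n) \<times> carrier (Zn n)"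
      using weight_preorder_coarsening[OF rP] by blast
    then show False
    proof cases
      case 1
      with card_s r(2) n show False by simp
    next
      case 2
      then have "nonneg n r f" for f using restrict_in_Zn by (simp add: nonneg_def)
      then have "i \<in> pivots n r" if "i < n" for i
        unfolding pivots_def indifferent_def
        using that by (auto intro!: exI[of _ "\<lambda>j. if j = i then 1 else 0"])
      then have "pivots n r = {..<n}" using pivots_subset by auto
      with r(2) n show False by simp
    qed
  qed
qed

text \<open>The trivial preorder is comparable with every other one, so a maximal chain contains it;
  alone it could be extended by the usual order, and chains have at most two members.\<close>

lemma maxchain_Z1:
  assumes "subset.maxchain (monoid_preorders (Zn 1)) R"
  shows "chain_length R = 1"
proof -
  let ?P = "monoid_preorders (Zn 1)" and ?top = "carrier (Zn 1) \<times> carrier (Zn 1)"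
  have chain: "subset.chain ?P R" and max: "\<And>S. subset.chain ?P S \<Longrightarrow> \<not> R \<subset> S"
    using assms by (auto simp: subset.maxchain_def)
  have top: "?top \<in> ?P" by (rule top_preorder[OF comm_monoid_Zn])
  have le_top: "r \<subseteq> ?top" if "r \<in> ?P" for r
    using that by (auto simp: monoid_preorders_def preorder_on_def)
  have lex: "lex_preorder 1 1 \<in> ?P" by (rule lex_preorder) simp
  have "lex_preorder 1 1 \<noteq> ?top"
  proof
    assume "lex_preorder 1 1 = ?top"
    then have "nonneg 1 (lex_preorder 1 1) (\<lambda>_. - 1)" using restrict_in_Zn by (simp add: nonneg_def)
    then show False by (auto simp: lex_preorder(2) dest: spec[of _ 0])
  qed
  then have card2: "card {?top, lex_preorder 1 1} = 2" by simp
  have "subset.chain ?P (insert ?top R)"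
    using chain top le_top unfolding subset_chain_def by auto
  then have top_mem: "?top \<in> R" using max by blast
  have "R \<noteq> {?top}"
  proof
    assume "R = {?top}"
    moreover have "subset.chain ?P {?top, lex_preorder 1 1}"
      using top lex le_top unfolding subset_chain_def by auto
    ultimately show False using max[of "{?top, lex_preorder 1 1}"] \<open>lex_preorder 1 1 \<noteq> ?top\<close> by blast
  qed
  then have "card R \<noteq> 1" using top_mem by (auto simp: card_1_singleton_iff)
  moreover have "card R \<noteq> 0" using top_mem chain_Zn_bound(1)[OF chain] by auto
  moreover have "card R \<le> 2" using chain_Zn_bound(2)[OF chain] by simp
  ultimately have "card R = 2" by linarith
  then show ?thesis using chain_Zn_bound(1)[OF chain] by (simp add: chain_length_def one_enat_def)
qed

lemma pure_dimensional_Z1: "pure_dimensional (preorder_space (Zn 1))"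
  unfolding pure_dimensional_preorder_space using maxchain_Z1 by simp

theorem theoremA:
  fixes G :: "('a, 'b) monoid_scheme"
  assumes "comm_monoid G"
  shows "irreducible_space (preorder_space G) \<and>
    spectral_space (preorder_space G) \<and>
    (finitely_generated_monoid G \<longrightarrow> td_space (preorder_space G)) \<and>
    (\<forall>n::nat. n \<ge> 1 \<longrightarrow>
       (\<not> noetherian_space (preorder_space (Mon n)) \<and>
        krull_dim (preorder_space (Mon n)) = \<infinity>) \<and>
       (krull_dim (preorder_space (Zn n)) = enat n \<and>
        (noetherian_space (preorder_space (Zn n)) \<longleftrightarrow> n = 1) \<and>
        (pure_dimensional (preorder_space (Zn n)) \<longleftrightarrow> n = 1)))"
proof (intro conjI allI impI)
  show "irreducible_space (preorder_space G)" by (rule irreducible_preorder_space[OF assms])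
  show "spectral_space (preorder_space G)" by (rule spectral_preorder_space)
  show "td_space (preorder_space G)" if "finitely_generated_monoid G"
    by (rule comm_monoid.td_preorder_space[OF assms that])
next
  fix n :: nat assume n: "n \<ge> 1"
  show "\<not> noetherian_space (preorder_space (Mon n))" by (rule not_noetherian_Mon[OF n])
  show "krull_dim (preorder_space (Mon n)) = \<infinity>" by (rule krull_dim_Mon[OF n])
  show "krull_dim (preorder_space (Zn n)) = enat n" by (rule krull_dim_Zn)
  have "n = 1 \<or> n \<ge> 2" using n by linarith
  then show "noetherian_space (preorder_space (Zn n)) \<longleftrightarrow> n = 1"
    and "pure_dimensional (preorder_space (Zn n)) \<longleftrightarrow> n = 1"
    using noetherian_Z1 not_noetherian_Zn[of n] pure_dimensional_Z1 not_pure_dimensional_Zn[of n]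
    by auto
qed

end
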